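(* Let $X$ be a locally compact, noncompact Polish space which admits a compatible metric $d$ such that $(X,d)$ is flexible, and let $A$ be a nonzero C*-algebra. Assume $\mathfrak d=\omega_1$ and $2^{\aleph_0}<2^{\aleph_1}$. Then $Q(X,A)=C_b(X,A)/C_0(X,A)$ has $2^{\aleph_1}$-many (pairwise distinct) automorphisms. In particular, under the Continuum Hypothesis, $Q(X,A)$ has $2^{\mathfrak c}$-many automorphisms.
   Context: $C_b(X,A)$ denotes the C*-algebra of bounded continuous functions $X\to A$ (sup norm, pointwise operations), $C_0(X,A)$ its ideal of functions vanishing at infinity, and $Q(X,A)=C_b(X,A)/C_0(X,A)$. $\mathfrak d$ is the least cardinality of a family $F\subseteq\mathbb N^{\mathbb N}$ that is cofinal for the eventual domination order $\le^*$ (where $f_1\le^* f_2$ means $f_1(n)\le f_2(n)$ for all but finitely many $n$). For a closed $Y\subseteq X$, let $\partial_X Y=Y\cap\overline{X\setminus Y}$, and let $\mathrm{Homeo}_{\partial}(Y)$ be the group of homeomorphisms $\phi$ of $Y$ with $\phi(y)=y$ for all $y\in\partial_X Y$; such $\phi$ extends to a homeomorphism $\tilde\phi$ of $X$ equal to $\phi$ on $Y$ and to the identity off $Y$. The radius of $\phi$ is $r(\phi)=\sup_{x\in X} d(x,\tilde\phi(x))$. A locally compact noncompact Polish space $X$ with compatible metric $d$ is flexible if there are pairwise disjoint sets $Y_n\subseteq X$ ($n\in\mathbb N$) and homeomorphisms $\phi_{n,m}\in\mathrm{Homeo}_\partial(Y_n)$ ($n,m\in\mathbb N$) such that: (1)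 each $Y_n$ is compact and no compact subset of $X$ meets infinitely many $Y_n$; (2) for each $n$, the sequence $(r(\phi_{n,m}))_m$ is decreasing and tends to $0$ as $m\to\infty$, and $r(\phi_{n,m})\neq 0$ for all $n,m$. *)

theory Defs
  imports "HOL-Analysis.Analysis" "HOL-Library.Equipollence" "HOL-Library.FuncSet"
begin

definition Polish_top :: "'a topology \<Rightarrow> bool" where
  "Polish_top X \<longleftrightarrow> separable_space X \<and> completely_metrizable_space X"

definition compatible_metric :: "('x::topological_space \<Rightarrow> 'x \<Rightarrow> real) \<Rightarrow> bool" where
  "compatible_metric d \<longleftrightarrow> Metric_space UNIV d \<and> Metric_space.mtopology UNIV d = euclidean"

definition rel_bdry :: "'x::topological_space set \<Rightarrow> 'x set" where
  "rel_bdry Y = Y \<inter> closure (- Y)"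

definition Homeo_bd :: "'x::topological_space set \<Rightarrow> ('x \<Rightarrow> 'x) set" where
  "Homeo_bd Y = {\<phi>. (\<exists>\<psi>. homeomorphism Y Y \<phi> \<psi>) \<and> (\<forall>y\<in>rel_bdry Y. \<phi> y = y)}"

definition ext_id :: "'x set \<Rightarrow> ('x \<Rightarrow> 'x) \<Rightarrow> 'x \<Rightarrow> 'x" where
  "ext_id Y \<phi> x = (if x \<in> Y then \<phi> x else x)"

definition radius :: "('x \<Rightarrow> 'x \<Rightarrow> real) \<Rightarrow> 'x set \<Rightarrow> ('x \<Rightarrow> 'x) \<Rightarrow> real" where
  "radius d Y \<phi> = (SUP x. d x (ext_id Y \<phi> x))"

definition flexible :: "('x::topological_space \<Rightarrow> 'x \<Rightarrow> real) \<Rightarrow> bool" where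
  "flexible d \<longleftrightarrow>
     (\<exists>(Y :: nat \<Rightarrow> 'x set) (\<phi> :: nat \<Rightarrow> nat \<Rightarrow> 'x \<Rightarrow> 'x).
        disjoint_family Y \<and>
        (\<forall>n m. \<phi> n m \<in> Homeo_bd (Y n)) \<and>
        (\<forall>n. compact (Y n)) \<and>
        (\<forall>K. compact K \<longrightarrow> finite {n. Y n \<inter> K \<noteq> {}}) \<and>
        (\<forall>n. decseq (\<lambda>m. radius d (Y n) (\<phi> n m)) \<and>
             (\<lambda>m. radius d (Y n) (\<phi> n m)) \<longlonglongrightarrow> 0 \<and>
             (\<forall>m. radius d (Y n) (\<phi> n m) \<noteq> 0)))"

class cstar_algebra = banach + real_normed_algebra +
  fixes scaleC :: "complex \<Rightarrow> 'a \<Rightarrow> 'a"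
    and cstar :: "'a \<Rightarrow> 'a"
  assumes scaleC_of_real: "scaleC (complex_of_real r) x = scaleR r x"
    and scaleC_add_right: "scaleC a (x + y) = scaleC a x + scaleC a y"
    and scaleC_add_left: "scaleC (a + b) x = scaleC a x + scaleC b x"
    and scaleC_scaleC: "scaleC a (scaleC b x) = scaleC (a * b) x"
    and scaleC_one: "scaleC 1 x = x"
    and scaleC_mult_left: "scaleC a x * y = scaleC a (x * y)"
    and scaleC_mult_right: "x * scaleC a y = scaleC a (x * y)"
    and norm_scaleC: "norm (scaleC a x) = cmod a * norm x"
    and cstar_add: "cstar (x + y) = cstar x + cstar y"
    and cstar_scaleC: "cstar (scaleC a x) = scaleC (cnj a) (cstar x)"
    and cstar_mult: "cstar (x * y) = cstar y * cstar x"
    and cstar_cstar: "cstar (cstar x) = x"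
    and cstar_identity: "norm (cstar x * x) = (norm x)\<^sup>2"

definition Cb :: "('x::topological_space \<Rightarrow> 'a::cstar_algebra) set" where
  "Cb = {f. continuous_on UNIV f \<and> bounded (range f)}"

definition C0 :: "('x::topological_space \<Rightarrow> 'a::cstar_algebra) set" where
  "C0 = {f. continuous_on UNIV f \<and>
            (\<forall>e>0. \<exists>K. compact K \<and> (\<forall>x. x \<notin> K \<longrightarrow> norm (f x) < e))}"

definition Qrel :: "(('x::topological_space \<Rightarrow> 'a::cstar_algebra) \<times> ('x \<Rightarrow> 'a)) set" where
  "Qrel = {(f, g). f \<in> Cb \<and> g \<in> Cb \<and> (\<lambda>x. f x - g x) \<in> C0}"

definition Qcarrier :: "('x::topological_space \<Rightarrow> 'a::cstar_algebra) set set" where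
  "Qcarrier = Cb // Qrel"

definition qclass :: "('x::topological_space \<Rightarrow> 'a::cstar_algebra) \<Rightarrow> ('x \<Rightarrow> 'a) set" where
  "qclass f = Qrel `` {f}"

definition qrep :: "('x \<Rightarrow> 'a) set \<Rightarrow> ('x \<Rightarrow> 'a)" where
  "qrep P = (SOME f. f \<in> P)"

definition qadd :: "('x::topological_space \<Rightarrow> 'a::cstar_algebra) set \<Rightarrow> ('x \<Rightarrow> 'a) set \<Rightarrow> ('x \<Rightarrow> 'a) set" where
  "qadd P R = qclass (\<lambda>x. qrep P x + qrep R x)"

definition qmult :: "('x::topological_space \<Rightarrow> 'a::cstar_algebra) set \<Rightarrow> ('x \<Rightarrow> 'a) set \<Rightarrow> ('x \<Rightarrow> 'a) set" where
  "qmult P R = qclass (\<lambda>x. qrep P x * qrep R x)"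

definition qscale :: "complex \<Rightarrow> ('x::topological_space \<Rightarrow> 'a::cstar_algebra) set \<Rightarrow> ('x \<Rightarrow> 'a) set" where
  "qscale c P = qclass (\<lambda>x. scaleC c (qrep P x))"

definition qstar :: "('x::topological_space \<Rightarrow> 'a::cstar_algebra) set \<Rightarrow> ('x \<Rightarrow> 'a) set" where
  "qstar P = qclass (\<lambda>x. cstar (qrep P x))"

definition Q_automorphisms ::
    "(('x::topological_space \<Rightarrow> 'a::cstar_algebra) set \<Rightarrow> ('x \<Rightarrow> 'a) set) set" where
  "Q_automorphisms = {\<Phi>. \<Phi> \<in> extensional Qcarrier \<and> bij_betw \<Phi> Qcarrier Qcarrier \<and>
      (\<forall>P\<in>Qcarrier. \<forall>R\<in>Qcarrier.
          \<Phi> (qadd P R) = qadd (\<Phi> P) (\<Phi> R) \<and> \<Phi> (qmult P R) = qmult (\<Phi> P) (\<Phi> R)) \<and>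
      (\<forall>P\<in>Qcarrier. \<forall>c. \<Phi> (qscale c P) = qscale c (\<Phi> P)) \<and>
      (\<forall>P\<in>Qcarrier. \<Phi> (qstar P) = qstar (\<Phi> P))}"

abbreviation omega1 :: "nat set set" where
  "omega1 \<equiv> Field (cardSuc natLeq)"

definition dominating :: "(nat \<Rightarrow> nat) set \<Rightarrow> bool" where
  "dominating F \<longleftrightarrow> (\<forall>g. \<exists>f\<in>F. \<forall>\<^sub>F n in sequentially. g n \<le> f n)"

definition dominating_number_is_omega1 :: bool where
  "dominating_number_is_omega1 \<longleftrightarrow>
     (\<exists>F. dominating F \<and> F \<approx> omega1) \<and> (\<forall>F. dominating F \<longrightarrow> \<not> F \<prec> omega1)"

end

theory Submission
  imports Defs
begin

text \<open>
  A function in \<open>C\<^sub>b(X, A)\<close> is uniformly continuous on each compact \<open>Y\<^sub>n\<close>, so it lies in one of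
  \<open>\<omega>\<^sub>1\<close> many sets \<open>D\<^sub>\<alpha>\<close> prescribed by moduli of continuity \<open>\<delta>\<^sub>\<alpha>(n)\<close> on the \<open>Y\<^sub>n\<close> that are
  obtained by refining a dominating family. By transfinite recursion one chooses homeomorphisms
  \<open>s\<^sub>\<alpha>\<close> of \<open>X\<close>, preserving every \<open>Y\<^sub>n\<close>, such that for \<open>\<beta> < \<alpha>\<close> the maps \<open>s\<^sub>\<alpha>\<close> and \<open>s\<^sub>\<beta>\<close> are
  \<open>\<delta>\<^sub>\<beta>(n)\<close>-close on \<open>Y\<^sub>n\<close> for almost all \<open>n\<close>; hence they induce the same map on \<open>D\<^sub>\<beta>\<close>
  modulo \<open>C\<^sub>0(X, A)\<close>, and together they define an automorphism. As \<open>\<alpha>\<close> has only countably many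
  predecessors, \<open>s\<^sub>\<alpha>\<close> is found by diagonalising over \<open>n\<close>. Composing it on \<open>Y\<^sub>n\<close> with a
  nontrivial homeomorphism of very small radius gives a second choice, and \<open>\<delta>\<^sub>\<alpha>\<close> is then taken so
  small that \<open>D\<^sub>\<alpha>\<close> distinguishes the two. Distinct subsets of \<open>\<omega>\<^sub>1\<close>, read as sequences of choices, yield distinct
  automorphisms.
\<close>

section \<open>The quotient algebra\<close>

text \<open>The C*-identity and submultiplicativity bound \<open>norm y\<close> by
  \<open>norm (cstar y)\<close>; taking \<open>x\<close> and \<open>cstar x\<close> for
  \<open>y\<close> gives both inequalities.\<close>

lemma norm_cstar [simp]: "norm (cstar x) = norm (x :: 'a::cstar_algebra)"
proof -
  have le: "norm y \<le> norm (cstar y)" for y :: 'a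
  proof (cases "norm y = 0")
    case False
    have "norm y * norm y \<le> norm (cstar y) * norm y"
      using cstar_identity[of y] norm_mult_ineq[of "cstar y" y] by (simp add: power2_eq_square)
    then show ?thesis
      using False by (simp add: mult_le_cancel_right)
  qed simp
  show ?thesis
    using le[of x] le[of "cstar x"] by (simp add: cstar_cstar)
qed

lemma bounded_linear_cstar: "bounded_linear (cstar :: 'a::cstar_algebra \<Rightarrow> 'a)"
proof (rule bounded_linear_intro[where K = 1])
  show "cstar (r *\<^sub>R x) = r *\<^sub>R cstar x" for r and x :: 'a
    by (simp flip: scaleC_of_real add: cstar_scaleC)
qed (auto simp: cstar_add)

lemma bounded_linear_scaleC: "bounded_linear (scaleC c :: 'a::cstar_algebra \<Rightarrow> 'a)"
proof (rule bounded_linear_intro[where K = "cmod c"])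
  show "scaleC c (r *\<^sub>R x) = r *\<^sub>R scaleC c x" for r and x :: 'a
    by (simp flip: scaleC_of_real add: scaleC_scaleC mult.commute)
qed (auto simp: scaleC_add_right norm_scaleC mult.commute)

section \<open>Bounded continuous functions\<close>

lemma CbI:
  assumes "continuous_on UNIV f" "\<And>x. norm (f x) \<le> B"
  shows "f \<in> Cb"
  using assms by (auto simp: Cb_def bounded_iff)

lemma CbE:
  assumes "f \<in> Cb"
  obtains B where "continuous_on UNIV f" "B > 0" "\<And>x. norm (f x) \<le> B"
proof -
  have "continuous_on UNIV f" "\<exists>B>0. \<forall>x. norm (f x) \<le> B"
    using assms by (auto simp: Cb_def bounded_pos)
  then show thesis
    using that by blast
qed

lemma Cb_add [intro]: "f \<in> Cb \<Longrightarrow> g \<in> Cb \<Longrightarrow> (\<lambda>x. f x + g x) \<in> Cb"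
  by (auto simp: Cb_def bounded_plus_comp intro!: continuous_intros)

lemma Cb_diff [intro]: "f \<in> Cb \<Longrightarrow> g \<in> Cb \<Longrightarrow> (\<lambda>x. f x - g x) \<in> Cb"
  by (auto simp: Cb_def bounded_minus_comp intro!: continuous_intros)

lemma Cb_mult [intro]:
  assumes "f \<in> Cb" "g \<in> Cb"
  shows "(\<lambda>x. f x * g x) \<in> Cb"
proof -
  obtain B where B: "continuous_on UNIV f" "B > 0" "\<And>x. norm (f x) \<le> B"
    using assms(1) by (rule CbE) blast
  obtain C where C: "continuous_on UNIV g" "C > 0" "\<And>x. norm (g x) \<le> C"
    using assms(2) by (rule CbE) blast
  show ?thesis
  proof (rule CbI)
    show "continuous_on UNIV (\<lambda>x. f x * g x)"
      using B C by (intro continuous_intros)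
    show "norm (f x * g x) \<le> B * C" for x
      by (rule order_trans[OF norm_mult_ineq]) (use B C in \<open>simp add: mult_mono\<close>)
  qed
qed

lemma Cb_bounded_linear:
  assumes "bounded_linear L" "f \<in> Cb"
  shows "(\<lambda>x. L (f x)) \<in> Cb"
proof -
  have "bounded (L ` range f)"
    using assms by (intro bounded_linear_image) (auto simp: Cb_def)
  then show ?thesis
    using assms bounded_linear.continuous_on[of L UNIV f] by (auto simp: Cb_def image_image)
qed

lemma Cb_scaleC [intro]: "f \<in> Cb \<Longrightarrow> (\<lambda>x. scaleC c (f x)) \<in> Cb"
  by (rule Cb_bounded_linear[OF bounded_linear_scaleC])

lemma Cb_cstar [intro]: "f \<in> Cb \<Longrightarrow> (\<lambda>x. cstar (f x)) \<in> Cb"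
  by (rule Cb_bounded_linear[OF bounded_linear_cstar])

text \<open>Comparison principle behind the closure of \<open>C0\<close> under bounded linear maps
  and under multiplication by \<open>Cb\<close>.\<close>

lemma C0_dominated:
  assumes "continuous_on UNIV f" "g \<in> C0" "\<And>x. norm (f x) \<le> B * norm (g x)"
  shows "f \<in> C0"
  unfolding C0_def
proof (intro CollectI conjI allI impI)
  fix e :: real
  assume "e > 0"
  \<comment> \<open>\<open>B\<close> carries no sign condition, so \<open>\<bar>B\<bar> + 1\<close>
    replaces it to give a positive divisor.\<close>
  then obtain K where K: "compact K" "\<And>x. x \<notin> K \<Longrightarrow> norm (g x) < e / (\<bar>B\<bar> + 1)"
    using assms(2) unfolding C0_def by (auto dest!: spec[of _ "e / (\<bar>B\<bar> + 1)"])
  have "norm (f x) < e" if "x \<notin> K" for x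
  proof -
    have "norm (f x) \<le> (\<bar>B\<bar> + 1) * norm (g x)"
      by (rule order_trans[OF assms(3)]) (simp add: mult_right_mono)
    also have "\<dots> < e"
      using K(2)[OF that] by (simp add: field_simps add_pos_nonneg)
    finally show ?thesis .
  qed
  then show "\<exists>K. compact K \<and> (\<forall>x. x \<notin> K \<longrightarrow> norm (f x) < e)"
    using K(1) by blast
qed (fact assms(1))

lemma C0_add:
  assumes "f \<in> C0" "g \<in> C0"
  shows "(\<lambda>x. f x + g x) \<in> C0"
  unfolding C0_def
proof (intro CollectI conjI allI impI)
  show "continuous_on UNIV (\<lambda>x. f x + g x)"
    using assms by (auto simp: C0_def intro!: continuous_intros)
  fix e :: real
  assume "e > 0"
  then obtain K L where K: "compact K" "\<And>x. x \<notin> K \<Longrightarrow> norm (f x) < e / 2"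
    and L: "compact L" "\<And>x. x \<notin> L \<Longrightarrow> norm (g x) < e / 2"
    using assms unfolding C0_def by (auto dest!: spec[of _ "e / 2"])
  have "norm (f x + g x) < e" if "x \<notin> K \<union> L" for x
    using K(2)[of x] L(2)[of x] that norm_triangle_ineq[of "f x" "g x"] by auto
  then show "\<exists>K. compact K \<and> (\<forall>x. x \<notin> K \<longrightarrow> norm (f x + g x) < e)"
    using K(1) L(1) by blast
qed

lemma C0_zero [simp]: "(\<lambda>x. 0) \<in> C0"
  by (auto simp: C0_def intro!: exI[of _ "{}"])

lemma C0_continuous: "f \<in> C0 \<Longrightarrow> continuous_on UNIV f"
  by (simp add: C0_def)

lemma C0_bounded_linear:
  assumes L: "bounded_linear L" and f: "f \<in> C0"
  shows "(\<lambda>x. L (f x)) \<in> C0"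
proof -
  obtain B where B: "\<And>x. norm (L x) \<le> norm x * B"
    using bounded_linear.bounded[OF L] by blast
  show ?thesis
  proof (rule C0_dominated[OF _ f])
    show "continuous_on UNIV (\<lambda>x. L (f x))"
      by (rule bounded_linear.continuous_on[OF L C0_continuous[OF f]])
    show "norm (L (f x)) \<le> B * norm (f x)" for x
      using B[of "f x"] by (simp add: mult.commute)
  qed
qed

lemma C0_uminus: "f \<in> C0 \<Longrightarrow> (\<lambda>x. - f x) \<in> C0"
  by (rule C0_bounded_linear[OF bounded_linear_minus[OF bounded_linear_ident]])

lemma C0_diff_commute: "(\<lambda>x. f x - g x) \<in> C0 \<Longrightarrow> (\<lambda>x. g x - f x) \<in> C0"
  by (drule C0_uminus) simp

lemma C0_diff_trans:
  "(\<lambda>x. f x - g x) \<in> C0 \<Longrightarrow> (\<lambda>x. g x - h x) \<in> C0 \<Longrightarrow> (\<lambda>x. f x - h x) \<in> C0"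
  by (drule (1) C0_add) simp

section \<open>The quotient and its operations\<close>

lemma equiv_Qrel: "equiv Cb Qrel"
  by (rule equivI)
    (auto simp: Qrel_def refl_on_def sym_def trans_def intro: C0_diff_commute C0_diff_trans)

lemma qclass_eq_iff:
  "f \<in> Cb \<Longrightarrow> g \<in> Cb \<Longrightarrow> qclass f = qclass g \<longleftrightarrow> (\<lambda>x. f x - g x) \<in> C0"
  using eq_equiv_class_iff[OF equiv_Qrel] by (auto simp: qclass_def Qrel_def)

lemma qclass_in_Qcarrier [intro]: "f \<in> Cb \<Longrightarrow> qclass f \<in> Qcarrier"
  by (simp add: qclass_def Qcarrier_def quotientI)

lemma qrep_qclass:
  assumes "f \<in> Cb"
  shows "qrep (qclass f) \<in> Cb" "(\<lambda>x. f x - qrep (qclass f) x) \<in> C0"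
proof -
  have "qrep (qclass f) \<in> qclass f"
    unfolding qrep_def
    by (rule someI[of _ f]) (use assms in \<open>auto simp: qclass_def Qrel_def\<close>)
  then show "qrep (qclass f) \<in> Cb" "(\<lambda>x. f x - qrep (qclass f) x) \<in> C0"
    by (auto simp: qclass_def Qrel_def)
qed

lemma Qcarrier_cases:
  assumes "P \<in> Qcarrier"
  obtains f where "f \<in> Cb" "P = qclass f"
  using assms unfolding Qcarrier_def qclass_def by (rule quotientE)

lemma qadd_qclass:
  assumes f: "f \<in> Cb" and g: "g \<in> Cb"
  shows "qadd (qclass f) (qclass g) = qclass (\<lambda>x. f x + g x)"
  unfolding qadd_def
proof (subst qclass_eq_iff)
  show "(\<lambda>x. qrep (qclass f) x + qrep (qclass g) x - (f x + g x)) \<in> C0"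
    using C0_add[OF qrep_qclass(2)[OF f, THEN C0_diff_commute] qrep_qclass(2)[OF g, THEN C0_diff_commute]]
    by (simp add: algebra_simps)
qed (use assms qrep_qclass in auto)

lemma C0_mult_Cb:
  assumes "f \<in> C0" "g \<in> Cb"
  shows "(\<lambda>x. f x * g x) \<in> C0" "(\<lambda>x. g x * f x) \<in> C0"
proof -
  obtain B where B: "continuous_on UNIV g" "B > 0" "\<And>x. norm (g x) \<le> B"
    using assms(2) by (rule CbE) blast
  have "norm (f x * g x) \<le> B * norm (f x)" for x
    by (rule order_trans[OF norm_mult_ineq])
      (use mult_left_mono[OF B(3)[of x], of "norm (f x)"] in \<open>simp add: mult.commute\<close>)
  then show "(\<lambda>x. f x * g x) \<in> C0"
    using B(1) C0_continuous[OF assms(1)]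
    by (intro C0_dominated[OF _ assms(1)] continuous_on_mult)
  have "norm (g x * f x) \<le> B * norm (f x)" for x
    by (rule order_trans[OF norm_mult_ineq]) (use B(3)[of x] in \<open>simp add: mult_right_mono\<close>)
  then show "(\<lambda>x. g x * f x) \<in> C0"
    using B(1) C0_continuous[OF assms(1)]
    by (intro C0_dominated[OF _ assms(1)] continuous_on_mult)
qed

lemma qmult_qclass:
  assumes f: "f \<in> Cb" and g: "g \<in> Cb"
  shows "qmult (qclass f) (qclass g) = qclass (\<lambda>x. f x * g x)"
  unfolding qmult_def
proof (subst qclass_eq_iff)
  let ?f = "qrep (qclass f)" and ?g = "qrep (qclass g)"
  have "(\<lambda>x. (?f x - f x) * ?g x) \<in> C0"
    by (rule C0_mult_Cb(1)[OF C0_diff_commute[OF qrep_qclass(2)[OF f]] qrep_qclass(1)[OF g]])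
  moreover have "(\<lambda>x. f x * (?g x - g x)) \<in> C0"
    by (rule C0_mult_Cb(2)[OF C0_diff_commute[OF qrep_qclass(2)[OF g]] f])
  ultimately have "(\<lambda>x. (?f x - f x) * ?g x + f x * (?g x - g x)) \<in> C0"
    by (rule C0_add)
  then show "(\<lambda>x. ?f x * ?g x - f x * g x) \<in> C0"
    by (simp add: algebra_simps)
qed (use f g in \<open>auto simp: qrep_qclass(1)\<close>)

lemma qclass_bounded_linear_qrep:
  assumes L: "bounded_linear L" and f: "f \<in> Cb"
  shows "qclass (\<lambda>x. L (qrep (qclass f) x)) = qclass (\<lambda>x. L (f x))"
proof -
  have "(\<lambda>x. L (qrep (qclass f) x - f x)) \<in> C0"
    by (rule C0_bounded_linear[OF L C0_diff_commute[OF qrep_qclass(2)[OF f]]])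
  then have "(\<lambda>x. L (qrep (qclass f) x) - L (f x)) \<in> C0"
    by (simp only: bounded_linear.linear[OF L, THEN linear_diff])
  then show ?thesis
    using qclass_eq_iff[OF Cb_bounded_linear[OF L qrep_qclass(1)[OF f]] Cb_bounded_linear[OF L f]]
    by simp
qed

lemma qscale_qclass: "f \<in> Cb \<Longrightarrow> qscale c (qclass f) = qclass (\<lambda>x. scaleC c (f x))"
  unfolding qscale_def by (rule qclass_bounded_linear_qrep[OF bounded_linear_scaleC])

lemma qstar_qclass: "f \<in> Cb \<Longrightarrow> qstar (qclass f) = qclass (\<lambda>x. cstar (f x))"
  unfolding qstar_def by (rule qclass_bounded_linear_qrep[OF bounded_linear_cstar])

section \<open>Composition with maps of the space\<close>

lemma Cb_comp:
  assumes "f \<in> Cb" "continuous_on UNIV S"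
  shows "(\<lambda>x. f (S x)) \<in> Cb"
proof -
  have "continuous_on UNIV (\<lambda>x. f (S x))"
    using assms continuous_on_compose2[of UNIV f UNIV S] by (simp add: Cb_def)
  moreover have "range (\<lambda>x. f (S x)) \<subseteq> range f"
    by blast
  ultimately show ?thesis
    using assms(1) by (auto simp: Cb_def intro: bounded_subset)
qed

text \<open>Smallness of \<open>f\<close> off \<open>K\<close> becomes smallness of the composite
  off the image of \<open>K\<close> under \<open>T\<close>, again compact.\<close>

lemma C0_comp:
  assumes "f \<in> C0" "homeomorphism UNIV UNIV S T"
  shows "(\<lambda>x. f (S x)) \<in> C0"
  unfolding C0_def
proof (intro CollectI conjI allI impI)
  show "continuous_on UNIV (\<lambda>x. f (S x))"
    using assms continuous_on_compose2[of UNIV f UNIV S] by (simp add: C0_def homeomorphism_def)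
  fix e :: real
  assume "e > 0"
  then obtain K where K: "compact K" "\<And>x. x \<notin> K \<Longrightarrow> norm (f x) < e"
    using assms(1) unfolding C0_def by blast
  have "compact (T ` K)"
    by (rule compact_continuous_image[OF continuous_on_subset[OF homeomorphism_cont2[OF assms(2)]] K(1)]) simp
  moreover have "S x \<notin> K" if "x \<notin> T ` K" for x
    using that homeomorphism_apply1[OF assms(2), of x] by (metis UNIV_I imageI)
  ultimately show "\<exists>K. compact K \<and> (\<forall>x. x \<notin> K \<longrightarrow> norm (f (S x)) < e)"
    using K(2) by blast
qed

section \<open>Automorphisms from coherent families of homeomorphisms\<close>

text \<open>An automorphism given locally: on \<open>D i\<close> it is composition with
  \<open>S i\<close>, and the regions overlap compatibly modulo \<open>C0\<close>.
  \<open>D_cover\<close> speaks of finite sets so that the arguments and the result of an algebraic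
  operation share one index.\<close>

locale coherent_family =
  fixes I :: "'i set"
    and S T :: "'i \<Rightarrow> 'x::topological_space \<Rightarrow> 'x"
    and D :: "'i \<Rightarrow> ('x \<Rightarrow> 'a::cstar_algebra) set"
  assumes homeo: "i \<in> I \<Longrightarrow> homeomorphism UNIV UNIV (S i) (T i)"
    and D_cong: "\<lbrakk>i \<in> I; f \<in> D i; g \<in> Cb; (\<lambda>x. f x - g x) \<in> C0\<rbrakk> \<Longrightarrow> g \<in> D i"
    and D_cover: "\<lbrakk>finite F; F \<subseteq> Cb\<rbrakk> \<Longrightarrow> \<exists>i\<in>I. F \<subseteq> D i"
    and coherent: "\<lbrakk>i \<in> I; j \<in> I; f \<in> Cb; f \<in> D i; f \<in> D j\<rbrakk> \<Longrightarrow> (\<lambda>x. f (S i x) - f (S j x)) \<in> C0"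
    and coherent_inv: "\<lbrakk>i \<in> I; j \<in> I; f \<in> Cb; f \<in> D i; f \<in> D j\<rbrakk> \<Longrightarrow> (\<lambda>x. f (T i x) - f (T j x)) \<in> C0"
begin

definition induced :: "('x \<Rightarrow> 'a) set \<Rightarrow> ('x \<Rightarrow> 'a) set" where
  "induced P = qclass (\<lambda>x. qrep P (S (SOME i. i \<in> I \<and> qrep P \<in> D i) x))"

lemma comp_Cb: "i \<in> I \<Longrightarrow> f \<in> Cb \<Longrightarrow> (\<lambda>x. f (S i x)) \<in> Cb"
  by (rule Cb_comp[OF _ homeomorphism_cont1[OF homeo]])

text \<open>The representative and index chosen in \<open>induced\<close> are immaterial: by
  \<open>D_cong\<close> the representative \<open>g\<close> also lies in \<open>D i\<close>, so
  coherence trades \<open>S j\<close> for \<open>S i\<close> on \<open>g\<close>, and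
  \<open>C0_comp\<close> then trades \<open>g\<close> for \<open>f\<close>.\<close>

lemma induced_qclass:
  assumes i: "i \<in> I" and f: "f \<in> Cb" "f \<in> D i"
  shows "induced (qclass f) = qclass (\<lambda>x. f (S i x))"
proof -
  define g where "g = qrep (qclass f)"
  have g: "g \<in> Cb" "(\<lambda>x. f x - g x) \<in> C0"
    using qrep_qclass[OF f(1)] by (auto simp: g_def)
  define j where "j = (SOME i. i \<in> I \<and> g \<in> D i)"
  have "\<exists>i. i \<in> I \<and> g \<in> D i"
    using D_cover[of "{g}"] g(1) by auto
  then have "j \<in> I \<and> g \<in> D j"
    unfolding j_def by (rule someI_ex)
  then have j: "j \<in> I" "g \<in> D j"
    by simp_all
  have "g \<in> D i"
    using D_cong[OF i f(2) g] .
  then have "(\<lambda>x. g (S j x) - g (S i x)) \<in> C0"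
    using coherent i j g(1) by blast
  moreover have "(\<lambda>x. g (S i x) - f (S i x)) \<in> C0"
    using C0_comp[OF C0_diff_commute[OF g(2)] homeo[OF i]] .
  ultimately have "(\<lambda>x. g (S j x) - f (S i x)) \<in> C0"
    by (rule C0_diff_trans)
  then have "qclass (\<lambda>x. g (S j x)) = qclass (\<lambda>x. f (S i x))"
    using comp_Cb[OF i f(1)] comp_Cb[OF j(1) g(1)] by (simp add: qclass_eq_iff)
  then show ?thesis
    by (simp add: induced_def flip: g_def j_def)
qed

lemma induced_in_Qcarrier: "P \<in> Qcarrier \<Longrightarrow> induced P \<in> Qcarrier"
proof (elim Qcarrier_cases)
  fix f :: "'x \<Rightarrow> 'a"
  assume f: "f \<in> Cb" "P = qclass f"
  obtain i where "i \<in> I" "f \<in> D i"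
    using D_cover[of "{f}"] f by auto
  then show ?thesis
    using f comp_Cb[of i f] by (auto simp: induced_qclass[of i f])
qed

text \<open>With both arguments and the result in one \<open>D i\<close>, all three classes are
  moved by composition with the same \<open>S i\<close>, which commutes with any pointwise
  operation.\<close>

lemma induced_binary:
  assumes closed: "\<And>f g :: 'x \<Rightarrow> 'a. f \<in> Cb \<Longrightarrow> g \<in> Cb \<Longrightarrow> (\<lambda>x. b (f x) (g x)) \<in> Cb"
    and B: "\<And>f g :: 'x \<Rightarrow> 'a. f \<in> Cb \<Longrightarrow> g \<in> Cb \<Longrightarrow> B (qclass f) (qclass g) = qclass (\<lambda>x. b (f x) (g x))"
    and PR: "P \<in> Qcarrier" "R \<in> Qcarrier"
  shows "induced (B P R) = B (induced P) (induced R)"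
proof -
  obtain f g where f: "f \<in> Cb" "P = qclass f" and g: "g \<in> Cb" "R = qclass g"
    using PR by (metis Qcarrier_cases)
  obtain i where i: "i \<in> I" "{f, g, \<lambda>x. b (f x) (g x)} \<subseteq> D i"
    using D_cover[of "{f, g, \<lambda>x. b (f x) (g x)}"] f(1) g(1) closed[OF f(1) g(1)] by auto
  then show ?thesis
    using f(1) g(1) closed[OF f(1) g(1)] comp_Cb[OF i(1) f(1)] comp_Cb[OF i(1) g(1)]
    unfolding f(2) g(2) by (simp add: B induced_qclass[OF i(1)])
qed

lemma induced_unary:
  assumes closed: "\<And>f :: 'x \<Rightarrow> 'a. f \<in> Cb \<Longrightarrow> (\<lambda>x. u (f x)) \<in> Cb"
    and U: "\<And>f :: 'x \<Rightarrow> 'a. f \<in> Cb \<Longrightarrow> U (qclass f) = qclass (\<lambda>x. u (f x))"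
    and P: "P \<in> Qcarrier"
  shows "induced (U P) = U (induced P)"
  \<comment> \<open>A unary operation is treated as a binary one that ignores its second
    argument.\<close>
  by (rule induced_binary[of "\<lambda>x y. u x" "\<lambda>P R. U P", OF _ _ P P]) (simp_all add: closed U)

end

text \<open>The axioms are symmetric in \<open>S\<close> and \<open>T\<close>; the map induced by
  the swapped family is the candidate inverse.\<close>

sublocale coherent_family \<subseteq> inv: coherent_family I T S D
  by (rule coherent_family.intro)
    (fact homeo[THEN homeomorphism_symD] D_cong D_cover coherent coherent_inv)+

context coherent_family
begin

lemma inv_induced_induced:
  assumes "P \<in> Qcarrier"
  shows "inv.induced (induced P) = P"
proof -
  obtain f where f: "f \<in> Cb" "P = qclass f"
    using assms by (rule Qcarrier_cases)
  obtain i where i: "i \<in> I" "f \<in> D i"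
    using D_cover[of "{f}"] f by auto
  define g where "g = (\<lambda>x. f (S i x))"
  have g: "g \<in> Cb"
    unfolding g_def by (rule comp_Cb[OF i(1) f(1)])
  \<comment> \<open>\<open>g\<close> may lie outside \<open>D i\<close>, so a new index
    \<open>j\<close> is taken whose region contains both \<open>f\<close> and \<open>g\<close>;
    coherence of \<open>i\<close> and \<open>j\<close> on \<open>f\<close> then lets
    \<open>T j\<close> cancel \<open>S i\<close> up to \<open>C0\<close>.\<close>
  obtain j where j: "j \<in> I" "f \<in> D j" "g \<in> D j"
    using D_cover[of "{f, g}"] f g by auto
  have "(\<lambda>x. g (T j x) - f (S j (T j x))) \<in> C0"
    unfolding g_def
    using C0_comp[OF coherent[OF i(1) j(1) f(1) i(2) j(2)] homeo[OF j(1), THEN homeomorphism_symD]] .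
  then have "(\<lambda>x. g (T j x) - f x) \<in> C0"
    using homeo[OF j(1)] by (simp add: homeomorphism_def)
  then have "qclass (\<lambda>x. g (T j x)) = qclass f"
    using inv.comp_Cb[OF j(1) g] f by (simp add: qclass_eq_iff)
  moreover have "induced P = qclass g"
    using induced_qclass[OF i(1) f(1) i(2)] f(2) by (simp add: g_def)
  ultimately show ?thesis
    using inv.induced_qclass[OF j(1) g j(3)] f by simp
qed

end

context coherent_family
begin

lemma induced_automorphism: "restrict induced Qcarrier \<in> Q_automorphisms"
proof -
  have "bij_betw induced Qcarrier Qcarrier"
  proof (rule bij_betw_byWitness[where f' = inv.induced])
    show "\<forall>P\<in>Qcarrier. induced (inv.induced P) = P"
      using inv.inv_induced_induced by blast
  qed (use inv_induced_induced induced_in_Qcarrier inv.induced_in_Qcarrier in auto)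
  moreover have "qadd P R \<in> Qcarrier" "qmult P R \<in> Qcarrier" "qscale c P \<in> Qcarrier" "qstar P \<in> Qcarrier"
    if "P \<in> Qcarrier" "R \<in> Qcarrier" for P R :: "('x \<Rightarrow> 'a) set" and c
    using that
    by (auto simp: qadd_qclass qmult_qclass qscale_qclass qstar_qclass
        Cb_add Cb_mult Cb_scaleC Cb_cstar intro!: qclass_in_Qcarrier elim!: Qcarrier_cases)
  moreover have "induced (qadd P R) = qadd (induced P) (induced R)"
    "induced (qmult P R) = qmult (induced P) (induced R)"
    if "P \<in> Qcarrier" "R \<in> Qcarrier" for P R
    by (rule induced_binary[where b = "(+)", OF Cb_add qadd_qclass that]
        induced_binary[where b = "(*)", OF Cb_mult qmult_qclass that]; assumption)+
  moreover have "induced (qscale c P) = qscale c (induced P)" "induced (qstar P) = qstar (induced P)"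
    if "P \<in> Qcarrier" for P c
    by (rule induced_unary[where u = "scaleC c", OF Cb_scaleC qscale_qclass that]
        induced_unary[where u = cstar, OF Cb_cstar qstar_qclass that]; assumption)+
  ultimately show ?thesis
    by (auto simp: Q_automorphisms_def)
qed

end

section \<open>Homeomorphisms supported on a locally finite family of compact sets\<close>

lemma homeomorphism_imp_inv:
  assumes "homeomorphism UNIV UNIV S T"
  shows "inv S = T"
  using assms by (intro inv_equality) (simp_all add: homeomorphism_def)

locale metrized_space =
  fixes d :: "'x::topological_space \<Rightarrow> 'x \<Rightarrow> real"
  assumes metric: "compatible_metric d"
begin

lemma Metric_space_d: "Metric_space UNIV d"
  using metric by (simp add: compatible_metric_def)

lemma d_nonneg [simp]: "0 \<le> d x y"
  by (rule Metric_space.nonneg[OF Metric_space_d])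

lemma d_commute: "d x y = d y x"
  by (rule Metric_space.commute[OF Metric_space_d])

lemma d_zero [simp]: "d x y = 0 \<longleftrightarrow> x = y"
  by (rule Metric_space.zero[OF Metric_space_d]) simp_all

lemma d_self [simp]: "d x x = 0"
  by simp

lemma d_triangle: "d x z \<le> d x y + d y z"
  by (rule Metric_space.triangle[OF Metric_space_d]) simp_all

lemma continuous_on_d:
  assumes "continuous_on UNIV f" "continuous_on UNIV g"
  shows "continuous_on UNIV (\<lambda>x. d (f x) (g x))"
proof -
  have top: "mtopology_of (metric (UNIV, d)) = euclidean"
    using metric Metric_space_d
    by (simp add: mtopology_of_def Metric_space.mspace_metric Metric_space.mdist_metric compatible_metric_def)
  have "continuous_map euclidean euclidean (\<lambda>x. mdist (metric (UNIV, d)) (f x) (g x))"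
    using assms by (intro continuous_map_mdist) (simp_all add: top)
  then show ?thesis
    by (simp add: Metric_space.mdist_metric[OF Metric_space_d])
qed

lemma metrizable: "metrizable_space (euclidean :: 'x topology)"
  using metric Metric_space.metrizable_space_mtopology[of UNIV d] by (simp add: compatible_metric_def)

lemma compact_imp_closed: "compact K \<Longrightarrow> closed (K :: 'x set)"
  using compactin_imp_closedin[OF metrizable_imp_Hausdorff_space[OF metrizable]] by simp

text \<open>The pairs from \<open>K\<close> at which \<open>u\<close> is at least \<open>e\<close>
  form a compact set off the diagonal. If it is nonempty, \<open>d\<close> attains a positive
  minimum there, and that minimum serves as \<open>\<delta>\<close>.\<close>

lemma uniformly_small_near_diagonal:
  assumes u: "continuous_on UNIV u" "\<And>x. u (x, x) = 0" and K: "compact K" and e: "(e::real) > 0"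
  shows "\<exists>\<delta>>0. \<forall>x\<in>K. \<forall>y\<in>K. d x y < \<delta> \<longrightarrow> u (x, y) < e"
proof -
  define C where "C = (K \<times> K) \<inter> {p. e \<le> u p}"
  have "compact C"
    unfolding C_def
    by (intro compact_Int_closed compact_Times K closed_Collect_le u(1) continuous_on_const)
  show ?thesis
  proof (cases "C = {}")
    case True
    then show ?thesis
      by (intro exI[of _ 1]) (auto simp: C_def not_le disjoint_iff)
  next
    case False
    have "continuous_on UNIV (\<lambda>p. d (fst p) (snd p))"
      by (intro continuous_on_d continuous_intros)
    then have "continuous_on C (\<lambda>p. d (fst p) (snd p))"
      by (rule continuous_on_subset) simp
    then obtain p where p: "p \<in> C" "\<And>q. q \<in> C \<Longrightarrow> d (fst p) (snd p) \<le> d (fst q) (snd q)"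
      using continuous_attains_inf[OF \<open>compact C\<close> False] by blast
    have "fst p \<noteq> snd p"
      using p(1) u(2)[of "fst p"] e unfolding C_def
      by (metis (mono_tags, lifting) IntD2 linorder_not_less mem_Collect_eq prod.collapse)
    then have "d (fst p) (snd p) > 0"
      using d_nonneg[of "fst p" "snd p"] d_zero[of "fst p" "snd p"] by linarith
    moreover have "u (x, y) < e" if "x \<in> K" "y \<in> K" "d x y < d (fst p) (snd p)" for x y
      using p(2)[of "(x, y)"] that by (auto simp: C_def not_le[symmetric])
    ultimately show ?thesis
      by blast
  qed
qed

end

text \<open>Working form of flexibility: \<open>small_homeo\<close> provides, for each piece,
  nontrivial homeomorphisms of the whole space that are supported on it and displace points
  arbitrarily little.\<close>

locale flexible_space = metrized_space d
  for d :: "'x::topological_space \<Rightarrow> 'x \<Rightarrow> real" +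
  fixes Y :: "nat \<Rightarrow> 'x set"
  assumes locally_compact: "locally_compact_space (euclidean :: 'x topology)"
    and disjoint: "disjoint_family Y"
    and compact_Y: "compact (Y n)"
    and finite_meet: "compact K \<Longrightarrow> finite {n. Y n \<inter> K \<noteq> {}}"
    and small_homeo: "e > 0 \<Longrightarrow>
      \<exists>\<psi>. homeomorphism UNIV UNIV \<psi> (inv \<psi>) \<and> (\<forall>x. x \<notin> Y n \<longrightarrow> \<psi> x = x) \<and> \<psi> \<noteq> id \<and> (\<forall>x. d x (\<psi> x) \<le> e)"
begin

lemma uniformly_continuous_Cb:
  fixes a :: "'x \<Rightarrow> 'a::cstar_algebra"
  assumes "a \<in> Cb" "e > 0"
  shows "\<exists>\<delta>>0. \<forall>x\<in>Y n. \<forall>y\<in>Y n. d x y < \<delta> \<longrightarrow> norm (a x - a y) < e"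
proof -
  have a: "continuous_on UNIV a"
    using assms(1) by (simp add: Cb_def)
  have "continuous_on UNIV (\<lambda>p. norm (a (fst p) - a (snd p)))"
    by (intro continuous_intros continuous_on_compose2[OF a]) auto
  from uniformly_small_near_diagonal[OF this _ compact_Y assms(2)] show ?thesis
    by simp
qed

lemma uniformly_continuous_self:
  assumes "continuous_on UNIV S" "e > 0"
  shows "\<exists>\<delta>>0. \<forall>x\<in>Y n. \<forall>y\<in>Y n. d x y < \<delta> \<longrightarrow> d (S x) (S y) < e"
proof -
  have "continuous_on UNIV (\<lambda>p. d (S (fst p)) (S (snd p)))"
    by (intro continuous_on_d continuous_on_compose2[OF assms(1)] continuous_intros) auto
  from uniformly_small_near_diagonal[OF this _ compact_Y assms(2)] show ?thesis
    by simp
qed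

lemma locally_finite: "\<exists>V. open V \<and> x \<in> V \<and> finite {n. Y n \<inter> V \<noteq> {}}"
proof -
  have "\<exists>U K. openin euclidean U \<and> compactin euclidean K \<and> x \<in> U \<and> U \<subseteq> K"
    using locally_compact by (simp add: locally_compact_space_def)
  then obtain U K where U: "open U" "compact K" "x \<in> U" "U \<subseteq> K"
    by auto
  have "finite {n. Y n \<inter> U \<noteq> {}}"
    by (rule finite_subset[OF _ finite_meet[OF U(2)]]) (use U(4) in blast)
  then show ?thesis
    using U by blast
qed

text \<open>The singletons \<open>{p n}\<close> form a locally finite family of closed sets, since
  every point has a neighbourhood meeting only finitely many pieces.\<close>

lemma closed_selection:
  assumes "\<And>n. p n \<in> Y n"
  shows "closed (range p)"
proof -
  have "closedin euclidean (\<Union>(range (\<lambda>n. {p n})))"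
  proof (rule closedin_locally_finite_Union)
    show "closedin euclidean S" if "S \<in> range (\<lambda>n. {p n})" for S
      using that compact_imp_closed[of S] by auto
    show "locally_finite_in euclidean (range (\<lambda>n. {p n}))"
      unfolding locally_finite_in_def
    proof (intro conjI ballI)
      fix x :: 'x
      obtain V where V: "open V" "x \<in> V" "finite {n. Y n \<inter> V \<noteq> {}}"
        using locally_finite by blast
      have "{U \<in> range (\<lambda>n. {p n}). U \<inter> V \<noteq> {}} \<subseteq> (\<lambda>n. {p n}) ` {n. Y n \<inter> V \<noteq> {}}"
        using assms by blast
      then have "finite {U \<in> range (\<lambda>n. {p n}). U \<inter> V \<noteq> {}}"
        using V(3) finite_surj by blast
      then show "\<exists>V. openin euclidean V \<and> x \<in> V \<and> finite {U \<in> range (\<lambda>n. {p n}). U \<inter> V \<noteq> {}}"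
        using V by auto
    qed simp
  qed
  then show ?thesis
    by (simp add: UNION_singleton_eq_range)
qed

section \<open>Pasting maps over the pieces\<close>

lemma Y_unique: "x \<in> Y n \<Longrightarrow> x \<in> Y m \<Longrightarrow> n = m"
  using disjoint by (auto simp: disjoint_family_on_def)

definition paste :: "(nat \<Rightarrow> 'x \<Rightarrow> 'x) \<Rightarrow> 'x \<Rightarrow> 'x" where
  "paste T x = (if x \<in> \<Union>(range Y) then T (THE n. x \<in> Y n) x else x)"

lemma paste_in [simp]: "x \<in> Y n \<Longrightarrow> paste T x = T n x"
proof -
  assume x: "x \<in> Y n"
  then have "(THE m. x \<in> Y m) = n"
    by (rule the_equality) (rule Y_unique[OF _ x])
  then show ?thesis
    using x by (auto simp: paste_def)
qed

lemma paste_out [simp]: "x \<notin> \<Union>(range Y) \<Longrightarrow> paste T x = x"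
  by (simp add: paste_def)

text \<open>The pieces and the closure of the complement of their union form a locally finite closed
  cover, so it suffices that the maps agree on overlaps.\<close>

lemma continuous_on_paste:
  assumes cont: "\<And>n. continuous_on UNIV (T n)"
    and out: "\<And>n x. x \<notin> \<Union>(range Y) \<Longrightarrow> T n x = x"
  shows "continuous_on UNIV (paste T)"
proof -
  let ?C = "closure (- \<Union>(range Y))"
  \<comment> \<open>Index \<open>None\<close> stands for the closure of the complement, carrying the
    identity; \<open>Some n\<close> stands for \<open>Y n\<close>, carrying
    \<open>T n\<close>.\<close>
  define A where "A = case_option ?C Y"
  define f where "f = case_option id T"
  \<comment> \<open>Agreement on the overlaps: the fixed points of \<open>T n\<close> are the zero
    set of a continuous function, hence closed, and they contain the complement of the
    union.\<close>
  have out_closure: "T n x = x" if "x \<in> ?C" for n x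
  proof -
    have "closed {x. d (T n x) x = 0}"
      by (intro closed_Collect_eq continuous_on_d continuous_intros cont)
    moreover have "- \<Union>(range Y) \<subseteq> {x. d (T n x) x = 0}"
      using out by auto
    ultimately show ?thesis
      using that closure_minimal[of "- \<Union>(range Y)" "{x. d (T n x) x = 0}"] by auto
  qed
  have "continuous_map euclidean euclidean (paste T)"
  proof (rule pasting_lemma_locally_finite[where I = UNIV and T = A and f = f])
    fix x :: 'x
    obtain V where V: "open V" "x \<in> V" "finite {n. Y n \<inter> V \<noteq> {}}"
      using locally_finite by blast
    have "{i \<in> UNIV. A i \<inter> V \<noteq> {}} \<subseteq> insert None (Some ` {n. Y n \<inter> V \<noteq> {}})"
    proof
      fix i
      assume "i \<in> {i \<in> UNIV. A i \<inter> V \<noteq> {}}"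
      then show "i \<in> insert None (Some ` {n. Y n \<inter> V \<noteq> {}})"
        by (cases i) (simp_all add: A_def)
    qed
    then have "finite {i \<in> UNIV. A i \<inter> V \<noteq> {}}"
      by (rule finite_subset) (simp add: V(3))
    then show "\<exists>V. openin euclidean V \<and> x \<in> V \<and> finite {i \<in> UNIV. A i \<inter> V \<noteq> {}}"
      using V by auto
  next
    show "closedin euclidean (A i)" for i
      using compact_imp_closed[OF compact_Y] by (cases i) (auto simp: A_def)
    show "continuous_map (top_of_set (A i)) euclidean (f i)" for i
    proof (cases i)
      case None
      then show ?thesis
        by (simp add: f_def id_def)
    next
      case (Some n)
      then show ?thesis
        using continuous_on_subset[OF cont[of n], of "Y n"] by (simp add: f_def A_def)
    qed
    show "f i x = f j x" if "x \<in> topspace euclidean \<inter> A i \<inter> A j" for i j x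
      using that by (cases i; cases j) (auto simp: f_def A_def out_closure dest: Y_unique)
    show "\<exists>j. j \<in> UNIV \<and> x \<in> A j \<and> paste T x = f j x" for x
    proof (cases "x \<in> \<Union>(range Y)")
      case True
      then obtain n where "x \<in> Y n"
        by blast
      then show ?thesis
        by (intro exI[of _ "Some n"]) (simp add: A_def f_def)
    next
      case False
      then show ?thesis
        using closure_subset[of "- \<Union>(range Y)"] by (intro exI[of _ None]) (auto simp: A_def f_def)
    qed
  qed
  then show ?thesis
    by simp
qed

text \<open>Invariance of every piece as a set is what allows elements of this group to be exchanged
  on one piece independently of the others.\<close>

definition G :: "('x \<Rightarrow> 'x) set" where
  "G = {S. homeomorphism UNIV UNIV S (inv S) \<and> (\<forall>n. S ` Y n = Y n) \<and> (\<forall>x. x \<notin> \<Union>(range Y) \<longrightarrow> S x = x)}"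

lemma GD:
  assumes "S \<in> G"
  shows "homeomorphism UNIV UNIV S (inv S)" "continuous_on UNIV S" "continuous_on UNIV (inv S)"
    "inv S (S x) = x" "S (inv S x) = x" "S ` Y n = Y n" "x \<notin> \<Union>(range Y) \<Longrightarrow> S x = x"
  using assms unfolding G_def homeomorphism_def by auto

lemma G_image: "S \<in> G \<Longrightarrow> x \<in> Y n \<Longrightarrow> S x \<in> Y n"
  using GD(6) by blast

lemma inv_in_G:
  assumes "S \<in> G"
  shows "inv S \<in> G"
proof -
  have "inv S ` Y n = Y n" for n
  proof -
    have "inv S ` (S ` Y n) = Y n"
      using GD(4)[OF assms] by (simp add: image_image)
    then show ?thesis
      by (simp only: GD(6)[OF assms])
  qed
  moreover have "inv S x = x" if "x \<notin> \<Union>(range Y)" for x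
    using GD(4)[OF assms, of x] GD(7)[OF assms that] by simp
  moreover have "inv (inv S) = S"
    by (rule homeomorphism_imp_inv[OF homeomorphism_symD[OF GD(1)[OF assms]]])
  ultimately show ?thesis
    using homeomorphism_symD[OF GD(1)[OF assms]] by (simp add: G_def)
qed

lemma id_in_G: "id \<in> G"
  using homeomorphism_ident[of "UNIV :: 'x set"] by (simp add: G_def id_def inv_id[unfolded id_def])

lemma comp_in_G:
  assumes "S \<in> G" "T \<in> G"
  shows "S \<circ> T \<in> G" "inv (S \<circ> T) = inv T \<circ> inv S"
proof -
  have h: "homeomorphism UNIV UNIV (S \<circ> T) (inv T \<circ> inv S)"
    by (rule homeomorphism_compose[OF GD(1)[OF assms(2)] GD(1)[OF assms(1)]])
  show eq: "inv (S \<circ> T) = inv T \<circ> inv S"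
    by (rule homeomorphism_imp_inv[OF h])
  have "(S \<circ> T) ` Y n = Y n" for n
    unfolding image_comp[symmetric] by (simp add: GD(6)[OF assms(1)] GD(6)[OF assms(2)])
  then show "S \<circ> T \<in> G"
    using h GD(7)[OF assms(1)] GD(7)[OF assms(2)] by (simp add: G_def eq)
qed

text \<open>As each \<open>T n\<close> maps \<open>Y n\<close> onto itself, inverses may be pasted
  piece by piece.\<close>

lemma paste_in_G:
  assumes T: "\<And>n. T n \<in> G"
  shows "paste T \<in> G" "inv (paste T) = paste (\<lambda>n. inv (T n))"
proof -
  have inverse: "paste U (paste V x) = x"
    if "\<And>n. V n \<in> G" "\<And>n x. U n (V n x) = x" for U V x
  proof (cases "x \<in> \<Union>(range Y)")
    case True
    then obtain n where "x \<in> Y n"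
      by blast
    then show ?thesis
      using that G_image[of "V n" x n] by simp
  qed simp
  have h: "homeomorphism UNIV UNIV (paste T) (paste (\<lambda>n. inv (T n)))"
  proof (rule homeomorphismI)
    show "continuous_on UNIV (paste T)" "continuous_on UNIV (paste (\<lambda>n. inv (T n)))"
      using GD[OF T] GD[OF inv_in_G[OF T]] by (auto intro!: continuous_on_paste)
    show "paste (\<lambda>n. inv (T n)) (paste T x) = x" "paste T (paste (\<lambda>n. inv (T n)) x) = x" for x
      using GD[OF T] T inv_in_G[OF T] by (auto intro!: inverse)
  qed auto
  then show eq: "inv (paste T) = paste (\<lambda>n. inv (T n))"
    by (rule homeomorphism_imp_inv)
  have "paste T ` Y n = Y n" for n
    using GD(6)[OF T[of n], of n] by (simp cong: image_cong)
  then show "paste T \<in> G"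
    using h by (simp add: G_def eq)
qed

text \<open>If \<open>\<psi> x\<close> lies outside \<open>Y n\<close> then it is fixed by
  \<open>\<psi>\<close>, and injectivity gives \<open>\<psi> x = x\<close>; thus
  \<open>\<psi>\<close> cannot carry points out of \<open>Y n\<close>.\<close>

lemma supported_in_G:
  assumes "homeomorphism UNIV UNIV \<psi> (inv \<psi>)" "\<And>x. x \<notin> Y n \<Longrightarrow> \<psi> x = x"
  shows "\<psi> \<in> G"
proof -
  have inv: "inv \<psi> (\<psi> x) = x" "\<psi> (inv \<psi> x) = x" for x
    using assms(1) by (auto simp: homeomorphism_def)
  have mem: "\<psi> x \<in> Y n \<longleftrightarrow> x \<in> Y n" for x
  proof (cases "\<psi> x \<in> Y n")
    case False
    then have "inv \<psi> (\<psi> (\<psi> x)) = inv \<psi> (\<psi> x)"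
      using assms(2) by simp
    then show ?thesis
      using False by (simp add: inv)
  next
    case True
    then show ?thesis
      using assms(2)[of x] by (cases "x \<in> Y n") simp_all
  qed
  have "\<psi> ` Y n = Y n"
  proof
    show "Y n \<subseteq> \<psi> ` Y n"
    proof
      fix y
      assume "y \<in> Y n"
      then show "y \<in> \<psi> ` Y n"
        using mem[of "inv \<psi> y"] by (intro image_eqI[of _ _ "inv \<psi> y"]) (simp_all add: inv)
    qed
  qed (use mem in blast)
  moreover have "\<psi> ` Y m = Y m" if "m \<noteq> n" for m
  proof -
    have "\<psi> x = x" if "x \<in> Y m" for x
      using assms(2)[of x] Y_unique[of x m n] that \<open>m \<noteq> n\<close> by blast
    then show ?thesis
      by simp
  qed
  ultimately have "\<psi> ` Y m = Y m" for m
    by (cases "m = n") auto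
  then show ?thesis
    using assms by (auto simp: G_def)
qed


section \<open>Vanishing at infinity tested on the pieces\<close>

lemma C0_eventually_small:
  assumes "f \<in> C0" "e > 0"
  shows "\<forall>\<^sub>F n in sequentially. \<forall>x\<in>Y n. norm (f x) < e"
proof -
  obtain K where K: "compact K" "\<And>x. x \<notin> K \<Longrightarrow> norm (f x) < e"
    using assms unfolding C0_def by blast
  have "\<forall>\<^sub>F n in sequentially. n \<notin> {n. Y n \<inter> K \<noteq> {}}"
    using finite_meet[OF K(1)] by (simp add: eventually_cofinite flip: cofinite_eq_sequentially)
  then show ?thesis
    by eventually_elim (use K(2) in blast)
qed

lemma eventually_small_imp_C0:
  assumes cont: "continuous_on UNIV f"
    and out: "\<And>x. x \<notin> \<Union>(range Y) \<Longrightarrow> f x = 0"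
    and small: "\<And>e. e > 0 \<Longrightarrow> \<forall>\<^sub>F n in sequentially. \<forall>x\<in>Y n. norm (f x) < e"
  shows "f \<in> C0"
  unfolding C0_def
proof (intro CollectI conjI allI impI cont)
  fix e :: real
  assume e: "e > 0"
  then obtain N where N: "\<And>n x. n \<ge> N \<Longrightarrow> x \<in> Y n \<Longrightarrow> norm (f x) < e"
    using small unfolding eventually_sequentially by meson
  have "norm (f x) < e" if x: "x \<notin> (\<Union>n<N. Y n)" for x
  proof (cases "x \<in> \<Union>(range Y)")
    case True
    then obtain n where n: "x \<in> Y n"
      by blast
    then have "n \<ge> N"
      using x by (meson UN_I lessThan_iff not_le)
    then show ?thesis
      using N n by blast
  qed (use out e in simp)
  moreover have "compact (\<Union>n<N. Y n)"
    by (intro compact_UN finite_lessThan compact_Y)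
  ultimately show "\<exists>K. compact K \<and> (\<forall>x. x \<notin> K \<longrightarrow> norm (f x) < e)"
    by blast
qed

text \<open>
  A function in \<^term>\<open>D \<delta>\<close> does not see, modulo \<^term>\<open>C0\<close>, a displacement of the points of
  \<^term>\<open>Y n\<close> by less than \<^term>\<open>\<delta> n\<close>. The slack \<^term>\<open>e < \<delta> n\<close> in \<open>near\<close> makes it an
  open condition, so that it survives small perturbations; inverses are included because the limit
  endomorphism has to be inverted as well.
\<close>

definition near :: "(nat \<Rightarrow> real) \<Rightarrow> ('x \<Rightarrow> 'x) \<Rightarrow> ('x \<Rightarrow> 'x) \<Rightarrow> nat \<Rightarrow> bool" where
  "near \<delta> S T n \<longleftrightarrow> (\<exists>e<\<delta> n. \<forall>x\<in>Y n. d (S x) (T x) \<le> e \<and> d (inv S x) (inv T x) \<le> e)"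

definition D :: "(nat \<Rightarrow> real) \<Rightarrow> ('x \<Rightarrow> 'a::cstar_algebra) set" where
  "D \<delta> = {a \<in> Cb. \<forall>e>0. \<forall>\<^sub>F n in sequentially.
      \<forall>x\<in>Y n. \<forall>y\<in>Y n. d x y < \<delta> n \<longrightarrow> norm (a x - a y) < e}"

lemma near_refl: "0 < \<delta> n \<Longrightarrow> near \<delta> S S n"
  unfolding near_def by (rule exI[of _ 0]) auto

lemma near_inv:
  assumes "S \<in> G" "T \<in> G" "near \<delta> S T n"
  shows "near \<delta> (inv S) (inv T) n"
proof -
  have "inv (inv U) = U" if "U \<in> G" for U
    by (rule homeomorphism_imp_inv[OF homeomorphism_symD[OF GD(1)[OF that]]])
  then show ?thesis
    using assms(3) by (simp add: near_def assms(1,2) conj_commute)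
qed

lemma near_paste:
  assumes "\<And>n. T n \<in> G"
  shows "near \<delta> (paste T) S n \<longleftrightarrow> near \<delta> (T n) S n"
  by (simp add: near_def paste_in_G(2)[OF assms])

lemma D_congruent:
  assumes f: "f \<in> D \<delta>" and g: "g \<in> Cb" "(\<lambda>x. f x - g x) \<in> C0"
  shows "g \<in> D \<delta>"
  unfolding D_def
proof (intro CollectI conjI allI impI g(1))
  fix e :: real
  assume "e > 0"
  then have e: "e / 3 > 0"
    by simp
  have "\<forall>\<^sub>F n in sequentially. \<forall>x\<in>Y n. \<forall>y\<in>Y n. d x y < \<delta> n \<longrightarrow> norm (f x - f y) < e / 3"
    using f e unfolding D_def by blast
  with C0_eventually_small[OF g(2) e]
  show "\<forall>\<^sub>F n in sequentially. \<forall>x\<in>Y n. \<forall>y\<in>Y n. d x y < \<delta> n \<longrightarrow> norm (g x - g y) < e"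
  proof eventually_elim
    case (elim n)
    show ?case
    proof (intro ballI impI)
      fix x y
      assume xy: "x \<in> Y n" "y \<in> Y n" "d x y < \<delta> n"
      have "norm (g x - g y) = norm ((f x - f y) - (f x - g x) + (f y - g y))"
        by simp
      also have "\<dots> \<le> norm (f x - f y) + norm (f x - g x) + norm (f y - g y)"
        by (intro order_trans[OF norm_triangle_ineq] add_right_mono norm_triangle_ineq4)
      also have "\<dots> < e / 3 + e / 3 + e / 3"
        using elim xy by (intro add_strict_mono) auto
      finally show "norm (g x - g y) < e"
        by simp
    qed
  qed
qed

text \<open>Source of coherence: on late pieces \<open>S x\<close> and \<open>T x\<close> stay in
  \<open>Y n\<close> at distance less than \<open>\<delta> n\<close>, where \<open>f\<close> varies
  little; outside the pieces both maps are the identity.\<close>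

lemma near_imp_C0:
  assumes S: "S \<in> G" and T: "T \<in> G" and near: "\<forall>\<^sub>F n in sequentially. near \<delta> S T n" and f: "f \<in> D \<delta>"
  shows "(\<lambda>x. f (S x) - f (T x)) \<in> C0"
proof (rule eventually_small_imp_C0)
  have "f \<in> Cb"
    using f by (simp add: D_def)
  from Cb_diff[OF Cb_comp[OF this GD(2)[OF S]] Cb_comp[OF this GD(2)[OF T]]]
  show "continuous_on UNIV (\<lambda>x. f (S x) - f (T x))"
    by (simp add: Cb_def)
  show "f (S x) - f (T x) = 0" if "x \<notin> \<Union>(range Y)" for x
    using GD(7)[OF S that] GD(7)[OF T that] by simp
  fix e :: real
  assume "e > 0"
  then have "\<forall>\<^sub>F n in sequentially. \<forall>x\<in>Y n. \<forall>y\<in>Y n. d x y < \<delta> n \<longrightarrow> norm (f x - f y) < e"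
    using f unfolding D_def by blast
  with near show "\<forall>\<^sub>F n in sequentially. \<forall>x\<in>Y n. norm (f (S x) - f (T x)) < e"
  proof eventually_elim
    case (elim n)
    show ?case
    proof
      fix x
      assume x: "x \<in> Y n"
      then have "d (S x) (T x) < \<delta> n"
        using elim(1) unfolding near_def by (meson le_less_trans)
      then show "norm (f (S x) - f (T x)) < e"
        using elim(2) G_image[OF S x] G_image[OF T x] by blast
    qed
  qed
qed

text \<open>A small displacement by \<open>\<psi>\<close> uses up only part of the slack: for
  \<open>t \<circ> \<psi>\<close> through uniform continuity of \<open>t\<close> on
  \<open>Y n\<close>, for the inverse directly. The filter form lets one radius meet finitely many
  such conditions.\<close>

lemma near_perturb:
  assumes t: "t \<in> G" and near: "near \<delta> t s n"
  shows "\<forall>\<^sub>F e in at_right (0::real). \<forall>\<psi>\<in>G. (\<forall>x. d x (\<psi> x) \<le> e) \<longrightarrow> near \<delta> (t \<circ> \<psi>) s n"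
proof -
  obtain e where e: "e < \<delta> n" "\<And>x. x \<in> Y n \<Longrightarrow> d (t x) (s x) \<le> e"
    "\<And>x. x \<in> Y n \<Longrightarrow> d (inv t x) (inv s x) \<le> e"
    using near unfolding near_def by blast
  define \<eta> where "\<eta> = (\<delta> n - e) / 2"
  have \<eta>: "\<eta> > 0" "e + \<eta> < \<delta> n"
    using e(1) by (auto simp: \<eta>_def field_simps)
  obtain \<zeta> where \<zeta>: "\<zeta> > 0" "\<And>x y. x \<in> Y n \<Longrightarrow> y \<in> Y n \<Longrightarrow> d x y < \<zeta> \<Longrightarrow> d (t x) (t y) < \<eta>"
    using uniformly_continuous_self[OF GD(2)[OF t] \<eta>(1)] by meson
  have "near \<delta> (t \<circ> \<psi>) s n" if r: "r < min \<zeta> \<eta>" and \<psi>: "\<psi> \<in> G" "\<forall>x. d x (\<psi> x) \<le> r" for r \<psi>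
    unfolding near_def comp_in_G(2)[OF t \<psi>(1)]
  proof (intro exI[of _ "e + \<eta>"] conjI ballI \<eta>(2))
    fix x
    assume x: "x \<in> Y n"
    have "d (\<psi> x) x < \<zeta>"
      using spec[OF \<psi>(2), of x] r by (simp add: d_commute[of "\<psi> x"])
    then have "d (t (\<psi> x)) (t x) < \<eta>"
      by (rule \<zeta>(2)[OF G_image[OF \<psi>(1) x] x])
    then show "d ((t \<circ> \<psi>) x) (s x) \<le> e + \<eta>"
      using e(2)[OF x] d_triangle[of "t (\<psi> x)" "s x" "t x"] by simp
    \<comment> \<open>\<open>\<psi>\<close> moves the point \<open>inv \<psi> (inv t x)\<close> to
      \<open>inv t x\<close>, so the bound on \<open>\<psi>\<close> also bounds its inverse.\<close>
    have "d (inv \<psi> (inv t x)) (\<psi> (inv \<psi> (inv t x))) \<le> r"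
      using \<psi>(2) by blast
    then have "d (inv \<psi> (inv t x)) (inv t x) < \<eta>"
      using r by (simp add: GD(5)[OF \<psi>(1)])
    then show "d ((inv \<psi> \<circ> inv t) x) (inv s x) \<le> e + \<eta>"
      using e(3)[OF x] d_triangle[of "inv \<psi> (inv t x)" "inv s x" "inv t x"] by simp
  qed
  then show ?thesis
    unfolding eventually_at_right_field using \<zeta>(1) \<eta>(1)
    by (intro exI[of _ "min \<zeta> \<eta>"]) simp
qed

text \<open>In an enumeration of \<open>B\<close>, \<open>u i\<close> handles the members up to
  index \<open>i\<close>. On \<open>Y n\<close> the map with the largest \<open>i \<le> n\<close>
  that already works at \<open>n\<close> is used; for the member with index \<open>j\<close> this is
  eventually some \<open>i \<ge> j\<close>, so nearness to it holds.\<close>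

lemma diagonal:
  fixes S :: "'b \<Rightarrow> 'x \<Rightarrow> 'x" and \<delta> :: "'b \<Rightarrow> nat \<Rightarrow> real"
  assumes B: "countable B"
    and directed: "\<And>F. finite F \<Longrightarrow> F \<subseteq> B \<Longrightarrow> \<exists>u\<in>G. \<forall>b\<in>F. \<forall>\<^sub>F n in sequentially. near (\<delta> b) u (S b) n"
  shows "\<exists>t\<in>G. \<forall>b\<in>B. \<forall>\<^sub>F n in sequentially. near (\<delta> b) t (S b) n"
proof (cases "B = {}")
  case True
  then show ?thesis
    by (intro bexI[of _ id]) (simp_all add: id_in_G)
next
  case False
  define F where "F i = from_nat_into B ` {..i}" for i :: nat
  have F: "finite (F i)" "F i \<subseteq> B" for i
    using from_nat_into[OF False] by (auto simp: F_def)
  have "\<forall>i. \<exists>u. u \<in> G \<and> (\<forall>b\<in>F i. \<forall>\<^sub>F n in sequentially. near (\<delta> b) u (S b) n)"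
    using directed[OF F] by blast
  from choice[OF this] obtain u where
    u: "\<And>i. u i \<in> G" "\<And>i b. b \<in> F i \<Longrightarrow> \<forall>\<^sub>F n in sequentially. near (\<delta> b) (u i) (S b) n"
    by blast
  define good where "good i n \<longleftrightarrow> (\<forall>b\<in>F i. near (\<delta> b) (u i) (S b) n)" for i n
  \<comment> \<open>For the finitely many \<open>n\<close> with an empty index set the value of \<open>Max\<close> is irrelevant.\<close>
  define t where "t n = u (Max {i. i \<le> n \<and> good i n})" for n
  have t: "t n \<in> G" for n
    using u(1) by (simp add: t_def)
  have "\<forall>\<^sub>F n in sequentially. near (\<delta> b) (paste t) (S b) n" if b: "b \<in> B" for b
  proof -
    obtain j where j: "b = from_nat_into B j"
      using from_nat_into_surj[OF B b] by blast
    have "\<forall>\<^sub>F n in sequentially. good j n"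
      unfolding good_def by (intro eventually_ball_finite F(1) ballI u(2))
    with eventually_ge_at_top[of j] show ?thesis
    proof eventually_elim
      case (elim n)
      let ?A = "{i. i \<le> n \<and> good i n}"
      have A: "finite ?A" "j \<in> ?A"
        using elim by auto
      then have "Max ?A \<in> ?A" "j \<le> Max ?A"
        using Max_in[OF A(1)] Max_ge[OF A] by blast+
      moreover from this(2) have "b \<in> F (Max ?A)"
        by (simp add: F_def j)
      ultimately have "near (\<delta> b) (t n) (S b) n"
        by (simp add: good_def t_def)
      then show ?case
        by (simp add: near_paste t)
    qed
  qed
  then show ?thesis
    by (intro bexI[of _ "paste t"] ballI paste_in_G(1)[OF t])
qed

text \<open>The two selections have closed ranges, which are disjoint because the pieces are;
  Urysohn's lemma gives a real function, which is multiplied by \<open>a0\<close>.\<close>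

lemma separating_function:
  fixes a0 :: "'a::cstar_algebra"
  assumes p: "\<And>n. p n \<in> Y n" and q: "\<And>n. q n \<in> Y n" and pq: "\<And>n. p n \<noteq> q n"
  shows "\<exists>a\<in>Cb. \<forall>n. a (p n) = 0 \<and> a (q n) = a0"
proof -
  have "p n \<noteq> q m" for n m
    using Y_unique[OF p, of n m] q[of m] pq[of n] by (cases "n = m") auto
  then have "disjnt (range p) (range q)"
    by (auto simp: disjnt_iff)
  moreover have "closedin euclidean (range p)" "closedin euclidean (range q)"
    using closed_selection[OF p] closed_selection[OF q] by simp_all
  ultimately obtain h :: "'x \<Rightarrow> real" where h: "continuous_map euclidean (top_of_set {0..1}) h"
    "h ` range p \<subseteq> {0}" "h ` range q \<subseteq> {1}"
    using Urysohn_lemma[OF metrizable_imp_normal_space[OF metrizable], of "range p" "range q" 0 1] by auto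
  have cont: "continuous_on UNIV h" and range: "\<And>x. h x \<in> {0..1}"
    using h(1) by (auto simp: continuous_map_in_subtopology)
  show ?thesis
  proof (intro bexI[of _ "\<lambda>x. h x *\<^sub>R a0"] allI conjI)
    show "(\<lambda>x. h x *\<^sub>R a0) \<in> Cb"
    proof (rule CbI)
      show "continuous_on UNIV (\<lambda>x. h x *\<^sub>R a0)"
        by (intro continuous_intros cont)
      show "norm (h x *\<^sub>R a0) \<le> norm a0" for x
        using range[of x] by (simp add: mult_left_le_one_le)
    qed
    show "h (p n) *\<^sub>R a0 = 0" "h (q n) *\<^sub>R a0 = a0" for n
      using h(2,3) by (simp_all add: image_subset_iff)
  qed
qed

text \<open>\<open>t\<close> comes from diagonalisation, and \<open>t'\<close> is \<open>t\<close>
  preceded on each \<open>Y n\<close> by a tiny nontrivial \<open>\<psi> n\<close>. A function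
  \<open>a\<close> with values \<open>0\<close> at \<open>t (x n)\<close> and \<open>a0\<close> at
  \<open>t' (x n)\<close> keeps the difference out of \<open>C0\<close>, and
  \<open>\<delta>'\<close> is taken below a modulus of continuity for it.\<close>

lemma two_extensions:
  fixes S :: "'b \<Rightarrow> 'x \<Rightarrow> 'x" and \<delta> :: "'b \<Rightarrow> nat \<Rightarrow> real" and a0 :: "'a::cstar_algebra"
  assumes B: "countable B"
    and directed: "\<And>F. finite F \<Longrightarrow> F \<subseteq> B \<Longrightarrow> \<exists>u\<in>G. \<forall>b\<in>F. \<forall>\<^sub>F n in sequentially. near (\<delta> b) u (S b) n"
    and a0: "a0 \<noteq> 0" and \<epsilon>: "\<And>n. \<epsilon> n > 0"
  obtains t t' \<delta>' and a :: "'x \<Rightarrow> 'a" where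
    "t \<in> G" "t' \<in> G" "\<And>n. 0 < \<delta>' n" "\<And>n. \<delta>' n \<le> \<epsilon> n"
    "\<And>b. b \<in> B \<Longrightarrow> \<forall>\<^sub>F n in sequentially. near (\<delta> b) t (S b) n"
    "\<And>b. b \<in> B \<Longrightarrow> \<forall>\<^sub>F n in sequentially. near (\<delta> b) t' (S b) n"
    "a \<in> D \<delta>'" "(\<lambda>x. a (t x) - a (t' x)) \<notin> C0"
proof -
  obtain t where t: "t \<in> G" and near_t: "\<And>b. b \<in> B \<Longrightarrow> \<forall>\<^sub>F n in sequentially. near (\<delta> b) t (S b) n"
    using diagonal[OF B directed] by blast
  \<comment> \<open>Stage \<open>n\<close> protects only the members of \<open>B\<close> with index
    up to \<open>n\<close>, finitely many, so one radius suffices; a fixed member is protected from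
    its own index on.\<close>
  have "\<exists>\<psi> x. \<psi> \<in> G \<and> x \<in> Y n \<and> \<psi> x \<noteq> x \<and>
      (\<forall>b\<in>from_nat_into B ` {..n}. near (\<delta> b) t (S b) n \<longrightarrow> near (\<delta> b) (t \<circ> \<psi>) (S b) n)" for n
  proof -
    have "\<forall>\<^sub>F e in at_right (0::real). \<forall>b\<in>from_nat_into B ` {..n}. near (\<delta> b) t (S b) n \<longrightarrow>
        (\<forall>\<psi>\<in>G. (\<forall>x. d x (\<psi> x) \<le> e) \<longrightarrow> near (\<delta> b) (t \<circ> \<psi>) (S b) n)"
      by (intro eventually_ball_finite ballI)
        (use near_perturb[OF t] in \<open>auto simp: eventually_conj_iff\<close>)
    then have "\<exists>e>0. \<forall>b\<in>from_nat_into B ` {..n}. near (\<delta> b) t (S b) n \<longrightarrow>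
        (\<forall>\<psi>\<in>G. (\<forall>x. d x (\<psi> x) \<le> e) \<longrightarrow> near (\<delta> b) (t \<circ> \<psi>) (S b) n)"
      by (rule eventually_happens'[OF trivial_limit_at_right_real eventually_conj[OF eventually_at_right_less]])
    then obtain e where e: "e > 0" "\<And>b \<psi>. \<lbrakk>b \<in> from_nat_into B ` {..n}; near (\<delta> b) t (S b) n; \<psi> \<in> G;
        \<forall>x. d x (\<psi> x) \<le> e\<rbrakk> \<Longrightarrow> near (\<delta> b) (t \<circ> \<psi>) (S b) n"
      by blast
    obtain \<psi> where \<psi>: "homeomorphism UNIV UNIV \<psi> (inv \<psi>)" "\<And>x. x \<notin> Y n \<Longrightarrow> \<psi> x = x" "\<psi> \<noteq> id"
      "\<forall>x. d x (\<psi> x) \<le> e"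
      using small_homeo[OF e(1), of n] by blast
    have "\<exists>x. \<psi> x \<noteq> x"
      using \<psi>(3) by auto
    then obtain x where "x \<in> Y n" "\<psi> x \<noteq> x"
      using \<psi>(2) by blast
    moreover have "\<psi> \<in> G"
      by (rule supported_in_G[OF \<psi>(1,2)])
    ultimately show ?thesis
      using e(2) \<psi>(4) by blast
  qed
  then have "\<forall>n. \<exists>\<psi> x. \<psi> \<in> G \<and> x \<in> Y n \<and> \<psi> x \<noteq> x \<and>
      (\<forall>b\<in>from_nat_into B ` {..n}. near (\<delta> b) t (S b) n \<longrightarrow> near (\<delta> b) (t \<circ> \<psi>) (S b) n)"
    by blast
  from choice[OF this] obtain \<psi> where "\<forall>n. \<exists>x. \<psi> n \<in> G \<and> x \<in> Y n \<and> \<psi> n x \<noteq> x \<and>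
      (\<forall>b\<in>from_nat_into B ` {..n}. near (\<delta> b) t (S b) n \<longrightarrow> near (\<delta> b) (t \<circ> \<psi> n) (S b) n)"
    by blast
  from choice[OF this] obtain x where \<psi>: "\<And>n. \<psi> n \<in> G" "\<And>n. x n \<in> Y n" "\<And>n. \<psi> n (x n) \<noteq> x n"
    "\<And>n b. \<lbrakk>b \<in> from_nat_into B ` {..n}; near (\<delta> b) t (S b) n\<rbrakk> \<Longrightarrow> near (\<delta> b) (t \<circ> \<psi> n) (S b) n"
    by blast
  define t' where "t' = paste (\<lambda>n. t \<circ> \<psi> n)"
  have comp: "t \<circ> \<psi> n \<in> G" for n
    by (rule comp_in_G(1)[OF t \<psi>(1)])
  have t': "t' \<in> G"
    unfolding t'_def by (rule paste_in_G(1)[OF comp])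
  have near_t': "\<forall>\<^sub>F n in sequentially. near (\<delta> b) t' (S b) n" if b: "b \<in> B" for b
  proof -
    obtain j where j: "b = from_nat_into B j"
      using from_nat_into_surj[OF B b] by blast
    from near_t[OF b] eventually_ge_at_top[of j] show ?thesis
    proof eventually_elim
      case (elim n)
      then have "near (\<delta> b) (t \<circ> \<psi> n) (S b) n"
        using j by (intro \<psi>(4)) auto
      then show ?case
        by (simp add: t'_def near_paste[OF comp])
    qed
  qed
  have inj: "t (x n) \<noteq> t (\<psi> n (x n))" for n
    using \<psi>(3)[of n] GD(4)[OF t, of "x n"] GD(4)[OF t, of "\<psi> n (x n)"] by auto
  obtain a :: "'x \<Rightarrow> 'a" where a: "a \<in> Cb" "\<And>n. a (t (x n)) = 0" "\<And>n. a (t (\<psi> n (x n))) = a0"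
    using separating_function[OF G_image[OF t \<psi>(2)] G_image[OF t G_image[OF \<psi>(1) \<psi>(2)]] inj] by blast
  \<comment> \<open>The tolerance \<open>1 / Suc n\<close> tends to \<open>0\<close>, which turns
    the separate moduli into membership in \<open>D \<delta>'\<close>.\<close>
  have "\<exists>\<delta>>0. \<forall>x\<in>Y n. \<forall>y\<in>Y n. d x y < \<delta> \<longrightarrow> norm (a x - a y) < 1 / Suc n" for n
    by (rule uniformly_continuous_Cb[OF a(1)]) simp
  then obtain \<gamma> where \<gamma>: "\<And>n. \<gamma> n > 0"
    "\<And>n x y. x \<in> Y n \<Longrightarrow> y \<in> Y n \<Longrightarrow> d x y < \<gamma> n \<Longrightarrow> norm (a x - a y) < 1 / Suc n"
    by metis
  define \<delta>' where "\<delta>' n = min (\<gamma> n) (\<epsilon> n)" for n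
  have "a \<in> D \<delta>'"
    unfolding D_def
  proof (intro CollectI conjI allI impI a(1))
    fix e :: real
    assume "e > 0"
    have "\<forall>\<^sub>F n in sequentially. 1 / real (Suc n) < e"
      using order_tendstoD(2)[OF lim_1_over_n[THEN LIMSEQ_Suc] \<open>e > 0\<close>] .
    then show "\<forall>\<^sub>F n in sequentially. \<forall>x\<in>Y n. \<forall>y\<in>Y n. d x y < \<delta>' n \<longrightarrow> norm (a x - a y) < e"
    proof eventually_elim
      case (elim n)
      show ?case
      proof (intro ballI impI)
        fix x y
        assume "x \<in> Y n" "y \<in> Y n" "d x y < \<delta>' n"
        then have "norm (a x - a y) < 1 / Suc n"
          by (intro \<gamma>(2)) (auto simp: \<delta>'_def)
        then show "norm (a x - a y) < e"
          using elim by linarith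
      qed
    qed
  qed
  moreover have "(\<lambda>x. a (t x) - a (t' x)) \<notin> C0"
  proof
    assume "(\<lambda>x. a (t x) - a (t' x)) \<in> C0"
    from C0_eventually_small[OF this, of "norm a0"] a0
    obtain n where "\<forall>y\<in>Y n. norm (a (t y) - a (t' y)) < norm a0"
      by (auto simp: eventually_sequentially)
    moreover have "a (t' (x n)) = a0"
      using \<psi>(2)[of n] by (simp add: t'_def a(3))
    ultimately show False
      using \<psi>(2)[of n] a(2)[of n] by auto
  qed
  moreover have "0 < \<delta>' n" "\<delta>' n \<le> \<epsilon> n" for n
    using \<gamma>(1) \<epsilon> by (auto simp: \<delta>'_def)
  ultimately show thesis
    by (intro that[OF t t' _ _ near_t near_t'])
qed


text \<open>Moduli of continuity are coded by natural numbers so that eventual domination applies to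
  them; finitely many functions are served by the maximum of their codes.\<close>

lemma D_absorbs:
  fixes F :: "('x \<Rightarrow> 'a::cstar_algebra) set"
  assumes "finite F" "F \<subseteq> Cb"
  shows "\<exists>g :: nat \<Rightarrow> nat. \<forall>\<delta>. (\<forall>\<^sub>F n in sequentially. \<delta> n \<le> 1 / real (Suc (g n))) \<longrightarrow> F \<subseteq> D \<delta>"
  using assms
proof induction
  case (insert a F)
  then obtain g where g: "\<And>\<delta>. (\<forall>\<^sub>F n in sequentially. \<delta> n \<le> 1 / real (Suc (g n))) \<Longrightarrow> F \<subseteq> D \<delta>"
    by auto
  have a: "a \<in> Cb"
    using insert.prems by simp
  have "\<exists>k. \<forall>x\<in>Y n. \<forall>y\<in>Y n. d x y < 1 / Suc k \<longrightarrow> norm (a x - a y) < 1 / Suc n" for n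
  proof -
    obtain \<gamma> where \<gamma>: "\<gamma> > 0" "\<forall>x\<in>Y n. \<forall>y\<in>Y n. d x y < \<gamma> \<longrightarrow> norm (a x - a y) < 1 / Suc n"
      using uniformly_continuous_Cb[OF a, of "1 / Suc n" n] by auto
    obtain k where "1 / real (Suc k) < \<gamma>"
      using reals_Archimedean[OF \<gamma>(1)] by (auto simp: inverse_eq_divide)
    then show ?thesis
      using \<gamma>(2) by (intro exI[of _ k]) auto
  qed
  then have "\<forall>n. \<exists>k. \<forall>x\<in>Y n. \<forall>y\<in>Y n. d x y < 1 / Suc k \<longrightarrow> norm (a x - a y) < 1 / Suc n"
    by blast
  from choice[OF this] obtain k where
    k: "\<And>n x y. x \<in> Y n \<Longrightarrow> y \<in> Y n \<Longrightarrow> d x y < 1 / Suc (k n) \<Longrightarrow> norm (a x - a y) < 1 / Suc n"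
    by blast
  show ?case
  proof (intro exI[of _ "\<lambda>n. max (g n) (k n)"] allI impI)
    fix \<delta> :: "nat \<Rightarrow> real"
    assume \<delta>: "\<forall>\<^sub>F n in sequentially. \<delta> n \<le> 1 / real (Suc (max (g n) (k n)))"
    have le: "1 / real (Suc (max (g n) (k n))) \<le> 1 / real (Suc (g n))"
      "1 / real (Suc (max (g n) (k n))) \<le> 1 / real (Suc (k n))" for n
      by (auto intro!: divide_left_mono)
    have "F \<subseteq> D \<delta>"
    proof (rule g)
      from \<delta> show "\<forall>\<^sub>F n in sequentially. \<delta> n \<le> 1 / real (Suc (g n))"
        by (rule eventually_mono) (rule order_trans[OF _ le(1)])
    qed
    moreover have "a \<in> D \<delta>"
      unfolding D_def
    proof (intro CollectI conjI allI impI a)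
      fix e :: real
      assume "e > 0"
      have "\<forall>\<^sub>F n in sequentially. 1 / real (Suc n) < e"
        using order_tendstoD(2)[OF lim_1_over_n[THEN LIMSEQ_Suc] \<open>e > 0\<close>] .
      with \<delta> show "\<forall>\<^sub>F n in sequentially. \<forall>x\<in>Y n. \<forall>y\<in>Y n. d x y < \<delta> n \<longrightarrow> norm (a x - a y) < e"
      proof eventually_elim
        case (elim n)
        show ?case
        proof (intro ballI impI)
          fix x y
          assume xy: "x \<in> Y n" "y \<in> Y n" "d x y < \<delta> n"
          then have "d x y < 1 / Suc (k n)"
            using elim(1) le(2)[of n] by linarith
          then show "norm (a x - a y) < e"
            using k[OF xy(1,2)] elim(2) by linarith
        qed
      qed
    qed
    ultimately show "insert a F \<subseteq> D \<delta>"
      by simp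
  qed
qed simp

end

section \<open>Branching along a well-order\<close>

lemma finite_linear_order_max:
  assumes r: "Linear_order r" and F: "finite F" "F \<noteq> {}" "F \<subseteq> Field r"
  shows "\<exists>m\<in>F. \<forall>b\<in>F. (b, m) \<in> r"
  using F
proof (induction rule: finite_ne_induct)
  case (singleton x)
  then show ?case
    using r by (auto simp: order_on_defs refl_on_def)
next
  case (insert x F)
  then obtain m where m: "m \<in> F" "\<And>b. b \<in> F \<Longrightarrow> (b, m) \<in> r"
    by auto
  have x: "(x, x) \<in> r" "x \<in> Field r" "m \<in> Field r"
    using r insert.prems m by (auto simp: order_on_defs refl_on_def)
  then consider "(x, m) \<in> r" | "(m, x) \<in> r"
    using r by (cases "x = m") (auto simp: order_on_defs total_on_def)
  then show ?case
  proof cases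
    case 1
    then show ?thesis
      using m by auto
  next
    case 2
    have "trans r"
      using r by (simp add: order_on_defs)
    then have "(b, x) \<in> r" if "b \<in> F" for b
      using m(2)[OF that] 2 by (rule transD)
    then show ?thesis
      using x by auto
  qed
qed

text \<open>A stage: the homeomorphism chosen there and the scale to which later stages must follow
  it.\<close>

type_synonym 'x state = "('x \<Rightarrow> 'x) \<times> (nat \<Rightarrow> real)"

text \<open>\<open>r\<close> takes the part of the first uncountable ordinal: its countable initial
  segments make diagonalisation possible, while \<open>f\<close> lists a dominating family along
  it.\<close>

locale branching = flexible_space d Y
  for d :: "'x::topological_space \<Rightarrow> 'x \<Rightarrow> real" and Y +
  fixes r :: "'i rel"
    and f :: "'i \<Rightarrow> nat \<Rightarrow> nat"
    and a0 :: "'a::cstar_algebra"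
  assumes well_order: "Well_order r"
    and countable_underS: "i \<in> Field r \<Longrightarrow> countable (underS r i)"
    and dominates: "\<exists>i\<in>Field r. \<forall>\<^sub>F n in sequentially. g n \<le> f i n"
    and a0: "a0 \<noteq> 0"
begin

text \<open>
  One scale \<open>\<delta>\<close> is chosen for both alternatives \<open>t\<close> and \<open>t'\<close>, fine enough that some function in
  \<^term>\<open>D \<delta>\<close> tells them apart. Every later stage agrees on \<^term>\<open>D \<delta>\<close> with the alternative chosen,
  so the difference persists in the limit.
\<close>

definition admissible ::
    "('i \<Rightarrow> 'x state) \<Rightarrow> 'i \<Rightarrow> ('x \<Rightarrow> 'x) \<times> ('x \<Rightarrow> 'x) \<times> (nat \<Rightarrow> real) \<Rightarrow> bool" where
  "admissible h i = (\<lambda>(t, t', \<delta>). t \<in> G \<and> t' \<in> G \<and> (\<forall>n. 0 < \<delta> n \<and> \<delta> n \<le> 1 / Suc (f i n)) \<and>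
     (\<forall>b\<in>underS r i. (\<forall>\<^sub>F n in sequentially. near (snd (h b)) t (fst (h b)) n) \<and>
        (\<forall>\<^sub>F n in sequentially. near (snd (h b)) t' (fst (h b)) n)) \<and>
     (\<exists>a :: 'x \<Rightarrow> 'a. a \<in> D \<delta> \<and> (\<lambda>x. a (t x) - a (t' x)) \<notin> C0))"

text \<open>The choice depends on the branch only through its history \<open>h\<close>; equal
  histories therefore offer the same pair of alternatives.\<close>

definition options :: "('i \<Rightarrow> 'x state) \<Rightarrow> 'i \<Rightarrow> ('x \<Rightarrow> 'x) \<times> ('x \<Rightarrow> 'x) \<times> (nat \<Rightarrow> real)" where
  "options h i = (SOME p. admissible h i p)"

definition step :: "'i set \<Rightarrow> ('i \<Rightarrow> 'x state) \<Rightarrow> 'i \<Rightarrow> 'x state" where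
  "step A h i = (case options h i of (t, t', \<delta>) \<Rightarrow> (if i \<in> A then t' else t, \<delta>))"

definition branch :: "'i set \<Rightarrow> 'i \<Rightarrow> 'x state" where
  "branch A = wfrec (r - Id) (step A)"

section \<open>The recursion and its invariant\<close>

lemma wf_r: "wf (r - Id)"
  using well_order by (simp add: well_order_on_def)

lemma underS_Field: "b \<in> underS r i \<Longrightarrow> b \<in> Field r"
  by (auto simp: underS_def Field_def)

lemma linear_cases:
  assumes "i \<in> Field r" "j \<in> Field r"
  obtains "i = j" | "i \<in> underS r j" | "j \<in> underS r i"
  using assms well_order unfolding order_on_defs total_on_def underS_def by blast

text \<open>\<open>admissible\<close> consults \<open>h\<close> only strictly below
  \<open>i\<close>, which justifies the well-founded recursion and later the comparison of two
  branches.\<close>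

lemma options_cong:
  assumes "\<And>b. b \<in> underS r i \<Longrightarrow> h b = h' b"
  shows "options h i = options h' i"
proof -
  have "admissible h i = admissible h' i"
    using assms by (simp add: admissible_def fun_eq_iff cong: ball_cong)
  then show ?thesis
    by (simp add: options_def)
qed

lemma branch_unfold: "branch A i = step A (branch A) i"
proof -
  have "branch A i = step A (cut (branch A) (r - Id) i) i"
    unfolding branch_def by (rule wfrec[OF wf_r])
  also have "options (cut (branch A) (r - Id) i) i = options (branch A) i"
    by (rule options_cong) (auto simp: cut_def underS_def)
  then have "step A (cut (branch A) (r - Id) i) i = step A (branch A) i"
    by (simp add: step_def)
  finally show ?thesis .
qed

lemma branch_induct [consumes 1]:
  assumes "i \<in> Field r" "\<And>i. i \<in> Field r \<Longrightarrow> (\<And>b. b \<in> underS r i \<Longrightarrow> P b) \<Longrightarrow> P i"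
  shows "P i"
proof -
  have "i \<in> Field r \<longrightarrow> P i"
    using wf_r
  proof (induction i rule: wf_induct_rule)
    case (less i)
    then show ?case
      using assms(2)[of i] underS_Field by (auto simp: underS_def)
  qed
  then show ?thesis
    using assms(1) by blast
qed

definition homeo_at :: "'i set \<Rightarrow> 'i \<Rightarrow> 'x \<Rightarrow> 'x" where
  "homeo_at A i = fst (branch A i)"

definition scale_at :: "'i set \<Rightarrow> 'i \<Rightarrow> nat \<Rightarrow> real" where
  "scale_at A i = snd (branch A i)"

definition good :: "'i set \<Rightarrow> 'i \<Rightarrow> bool" where
  "good A i \<longleftrightarrow> homeo_at A i \<in> G \<and> (\<forall>n. 0 < scale_at A i n \<and> scale_at A i n \<le> 1 / Suc (f i n)) \<and>
     (\<forall>b\<in>underS r i. \<forall>\<^sub>F n in sequentially. near (scale_at A b) (homeo_at A i) (homeo_at A b) n)"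

lemma admissible_good:
  assumes "admissible (branch A) i (options (branch A) i)"
  shows "good A i"
proof -
  obtain t t' \<delta> where p: "options (branch A) i = (t, t', \<delta>)"
    by (metis prod_cases3)
  have "homeo_at A i = (if i \<in> A then t' else t)" "scale_at A i = \<delta>"
    by (simp_all add: homeo_at_def scale_at_def branch_unfold[of A i] step_def p)
  then show ?thesis
    using assms unfolding p admissible_def good_def
    by (simp add: homeo_at_def[symmetric] scale_at_def[symmetric])
qed

text \<open>Directedness below \<open>i\<close>: for finite nonempty \<open>F\<close> the map at its
  greatest member \<open>m\<close> works, being near the earlier ones by the invariant and near
  itself because its scale is positive.\<close>

lemma admissible_exists:
  assumes i: "i \<in> Field r" and IH: "\<And>b. b \<in> underS r i \<Longrightarrow> good A b"
  shows "\<exists>p. admissible (branch A) i p"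
proof -
  have "\<exists>u\<in>G. \<forall>b\<in>F. \<forall>\<^sub>F n in sequentially. near (scale_at A b) u (homeo_at A b) n"
    if F: "finite F" "F \<subseteq> underS r i" for F
  proof (cases "F = {}")
    case True
    then show ?thesis
      using id_in_G by auto
  next
    case False
    have "Linear_order r"
      using well_order by (simp add: well_order_on_def)
    moreover have "F \<subseteq> Field r"
      using F(2) underS_Field by blast
    ultimately obtain m where m: "m \<in> F" "\<And>b. b \<in> F \<Longrightarrow> (b, m) \<in> r"
      using finite_linear_order_max[OF _ F(1) False] by blast
    have good: "good A m"
      using IH F(2) m(1) by blast
    have "\<forall>\<^sub>F n in sequentially. near (scale_at A b) (homeo_at A m) (homeo_at A b) n" if b: "b \<in> F" for b
    proof (cases "b = m")
      case True
      have "near (scale_at A m) (homeo_at A m) (homeo_at A m) n" for n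
        using good by (intro near_refl) (simp add: good_def)
      then show ?thesis
        using True by simp
    next
      case False
      then have "b \<in> underS r m"
        using m(2)[OF b] by (simp add: underS_def)
      then show ?thesis
        using good by (simp add: good_def)
    qed
    then show ?thesis
      using good by (intro bexI[of _ "homeo_at A m"]) (simp_all add: good_def)
  qed
  note directed = this
  have pos: "0 < 1 / real (Suc (f i n))" for n
    by simp
  show ?thesis
  proof (rule two_extensions[where \<epsilon> = "\<lambda>n. 1 / Suc (f i n)", OF countable_underS[OF i] directed a0 pos])
    fix t t' \<delta>' and a :: "'x \<Rightarrow> 'a"
    assume "t \<in> G" "t' \<in> G" "\<And>n. 0 < \<delta>' n" "\<And>n. \<delta>' n \<le> 1 / Suc (f i n)"
      "\<And>b. b \<in> underS r i \<Longrightarrow> \<forall>\<^sub>F n in sequentially. near (scale_at A b) t (homeo_at A b) n"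
      "\<And>b. b \<in> underS r i \<Longrightarrow> \<forall>\<^sub>F n in sequentially. near (scale_at A b) t' (homeo_at A b) n"
      "a \<in> D \<delta>'" "(\<lambda>x. a (t x) - a (t' x)) \<notin> C0"
    then have "admissible (branch A) i (t, t', \<delta>')"
      unfolding admissible_def homeo_at_def[symmetric] scale_at_def[symmetric]
      by (simp del: of_nat_Suc) blast
    then show ?thesis
      by blast
  qed
qed

lemma branch_good:
  assumes "i \<in> Field r"
  shows "good A i"
  using assms
proof (induction rule: branch_induct)
  case (1 i)
  then show ?case
    using admissible_exists[of i A] unfolding options_def
    by (intro admissible_good) (simp add: options_def someI_ex)
qed

lemma options_admissible:
  assumes "i \<in> Field r"
  shows "admissible (branch A) i (options (branch A) i)"
  unfolding options_def
  by (rule someI_ex[OF admissible_exists[OF assms branch_good[OF underS_Field]]])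

text \<open>A later stage follows an earlier one at the scale of the earlier, so the smaller index
  does the work; the other order of indices follows by changing the sign of the difference.\<close>

lemma homeo_at_coherent:
  fixes a :: "'x \<Rightarrow> 'b::cstar_algebra"
  assumes ij: "i \<in> Field r" "j \<in> Field r" and a: "a \<in> D (scale_at A i)" "a \<in> D (scale_at A j)"
  shows "(\<lambda>x. a (homeo_at A i x) - a (homeo_at A j x)) \<in> C0"
    "(\<lambda>x. a (inv (homeo_at A i) x) - a (inv (homeo_at A j) x)) \<in> C0"
proof -
  have below: "(\<lambda>x. a (homeo_at A i x) - a (homeo_at A j x)) \<in> C0 \<and>
      (\<lambda>x. a (inv (homeo_at A i) x) - a (inv (homeo_at A j) x)) \<in> C0"
    if "i \<in> Field r" "j \<in> underS r i" "a \<in> D (scale_at A j)" for i j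
  proof -
    have G: "homeo_at A i \<in> G" "homeo_at A j \<in> G"
      using branch_good[OF that(1)] branch_good[OF underS_Field[OF that(2)]] by (simp_all add: good_def)
    have near: "\<forall>\<^sub>F n in sequentially. near (scale_at A j) (homeo_at A i) (homeo_at A j) n"
      using branch_good[OF that(1)] that(2) by (simp add: good_def)
    then have "\<forall>\<^sub>F n in sequentially. near (scale_at A j) (inv (homeo_at A i)) (inv (homeo_at A j)) n"
      by (rule eventually_mono) (rule near_inv[OF G])
    then show ?thesis
      using near_imp_C0[OF G near that(3)] near_imp_C0[OF inv_in_G[OF G(1)] inv_in_G[OF G(2)] _ that(3)]
      by blast
  qed
  have "(\<lambda>x. a (homeo_at A i x) - a (homeo_at A j x)) \<in> C0 \<and>
      (\<lambda>x. a (inv (homeo_at A i) x) - a (inv (homeo_at A j) x)) \<in> C0"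
    using ij
  proof (cases rule: linear_cases)
    case 2
    show ?thesis
      using below[OF ij(2) 2 a(1), THEN conjunct1, THEN C0_diff_commute]
        below[OF ij(2) 2 a(1), THEN conjunct2, THEN C0_diff_commute] by (rule conjI)
  next
    case 3
    then show ?thesis
      using below[OF ij(1) 3 a(2)] by blast
  qed simp
  then show "(\<lambda>x. a (homeo_at A i x) - a (homeo_at A j x)) \<in> C0"
    "(\<lambda>x. a (inv (homeo_at A i) x) - a (inv (homeo_at A j) x)) \<in> C0"
    by blast+
qed

text \<open>The code of \<open>F\<close> from \<open>D_absorbs\<close> is eventually dominated by
  some \<open>f i\<close>, and the scale at stage \<open>i\<close> is at most
  \<open>1 / Suc (f i n)\<close>.\<close>

lemma D_scale_at_cover:
  fixes F :: "('x \<Rightarrow> 'a) set"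
  assumes "finite F" "F \<subseteq> Cb"
  shows "\<exists>i\<in>Field r. F \<subseteq> D (scale_at A i)"
proof -
  obtain g :: "nat \<Rightarrow> nat" where
    g: "\<And>\<delta>. (\<forall>\<^sub>F n in sequentially. \<delta> n \<le> 1 / real (Suc (g n))) \<Longrightarrow> F \<subseteq> D \<delta>"
    using D_absorbs[OF assms] by blast
  obtain i where i: "i \<in> Field r" "\<forall>\<^sub>F n in sequentially. g n \<le> f i n"
    using dominates by blast
  have "\<forall>\<^sub>F n in sequentially. scale_at A i n \<le> 1 / real (Suc (g n))"
    using i(2)
  proof eventually_elim
    case (elim n)
    have "scale_at A i n \<le> 1 / Suc (f i n)"
      using branch_good[OF i(1)] by (simp add: good_def)
    also have "\<dots> \<le> 1 / Suc (g n)"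
      using elim by (intro divide_left_mono) auto
    finally show ?case .
  qed
  then show ?thesis
    using g i(1) by blast
qed

lemma coherent_family_branch:
  "coherent_family (Field r) (homeo_at A) (\<lambda>i. inv (homeo_at A i))
     (\<lambda>i. D (scale_at A i) :: ('x \<Rightarrow> 'a) set)"
proof (rule coherent_family.intro)
  show "homeomorphism UNIV UNIV (homeo_at A i) (inv (homeo_at A i))" if "i \<in> Field r" for i
    using branch_good[OF that, of A] by (intro GD(1)) (simp add: good_def)
qed (fact D_scale_at_cover | rule D_congruent homeo_at_coherent; assumption)+

section \<open>The automorphism of a branch\<close>

definition automorphism :: "'i set \<Rightarrow> ('x \<Rightarrow> 'a) set \<Rightarrow> ('x \<Rightarrow> 'a) set" where
  "automorphism A = restrict
     (coherent_family.induced (Field r) (homeo_at A) (\<lambda>i. D (scale_at A i))) Qcarrier"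

lemma automorphism_qclass:
  assumes "i \<in> Field r" "a \<in> D (scale_at A i)"
  shows "automorphism A (qclass a) = qclass (\<lambda>x. a (homeo_at A i x))"
proof -
  have "a \<in> Cb"
    using assms(2) by (simp add: D_def)
  then show ?thesis
    using coherent_family.induced_qclass[OF coherent_family_branch assms(1) _ assms(2)]
    by (simp add: automorphism_def qclass_in_Qcarrier)
qed

text \<open>At a minimal \<open>i\<close> where \<open>A\<close> and \<open>B\<close> differ the
  histories agree, so one branch takes \<open>t\<close> and the other \<open>t'\<close>, with a
  common scale \<open>\<delta>\<close>. The separating \<open>a\<close> lies in
  \<open>D \<delta>\<close>, hence stage \<open>i\<close> alone computes both automorphisms on its
  class.\<close>

lemma automorphism_inj: "inj_on automorphism (Pow (Field r))"
proof (rule inj_onI, rule ccontr)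
  fix A B
  assume AB: "A \<in> Pow (Field r)" "B \<in> Pow (Field r)" "automorphism A = automorphism B" "A \<noteq> B"
  obtain k where "k \<in> (A - B) \<union> (B - A)"
    using AB(4) by blast
  then obtain i where i: "i \<in> (A - B) \<union> (B - A)"
    "\<And>b. (b, i) \<in> r - Id \<Longrightarrow> b \<notin> (A - B) \<union> (B - A)"
    using wfE_min[OF wf_r] by metis
  have iF: "i \<in> Field r"
    using i(1) AB(1,2) by blast
  have trans: "trans r"
    using well_order by (simp add: order_on_defs)
  have antisym: "antisym r"
    using well_order by (simp add: order_on_defs)
  \<comment> \<open>Below \<open>i\<close> the sets agree, so by induction both branches make the
    same choices.\<close>
  have "b \<in> underS r i \<longrightarrow> branch A b = branch B b" if "b \<in> Field r" for b
    using that
  proof (induction rule: branch_induct)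
    case (1 b)
    show ?case
    proof
      assume b: "b \<in> underS r i"
      have "c \<in> underS r i" if "c \<in> underS r b" for c
        using that b trans antisym unfolding underS_def by (auto dest: transD antisymD)
      then have "options (branch A) b = options (branch B) b"
        using 1 by (intro options_cong) blast
      moreover have "b \<in> A \<longleftrightarrow> b \<in> B"
        using i(2)[of b] b by (auto simp: underS_def)
      ultimately show "branch A b = branch B b"
        by (simp add: branch_unfold[of _ b] step_def)
    qed
  qed
  then have eq: "options (branch A) i = options (branch B) i"
    using underS_Field by (intro options_cong) blast
  obtain t t' \<delta> where p: "options (branch B) i = (t, t', \<delta>)"
    by (metis prod_cases3)
  have homeo: "homeo_at C i = (if i \<in> C then t' else t)" "scale_at C i = \<delta>" if "C = A \<or> C = B" for C
    using that by (auto simp: homeo_at_def scale_at_def branch_unfold[of _ i] step_def p eq)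
  obtain a :: "'x \<Rightarrow> 'a" where a: "a \<in> D \<delta>" "(\<lambda>x. a (t x) - a (t' x)) \<notin> C0"
    using options_admissible[OF iF, of B] unfolding p admissible_def by auto
  have "automorphism C (qclass a) = qclass (\<lambda>x. a (homeo_at C i x))" if "C = A \<or> C = B" for C
    using automorphism_qclass[OF iF] homeo(2)[OF that] a(1) by simp
  then have "qclass (\<lambda>x. a (homeo_at A i x)) = qclass (\<lambda>x. a (homeo_at B i x))"
    using AB(3) by metis
  then have "qclass (\<lambda>x. a (t x)) = qclass (\<lambda>x. a (t' x))"
    using homeo(1) i(1) by (auto split: if_splits)
  moreover have "t \<in> G" "t' \<in> G" "a \<in> Cb"
    using options_admissible[OF iF, of B] a(1) unfolding p admissible_def D_def by auto
  ultimately show False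
    using a(2) qclass_eq_iff[OF Cb_comp Cb_comp] GD(2) by blast
qed

theorem Pow_lepoll_automorphisms:
  "Pow (Field r) \<lesssim> (Q_automorphisms :: (('x \<Rightarrow> 'a) set \<Rightarrow> ('x \<Rightarrow> 'a) set) set)"
  unfolding lepoll_def
  using automorphism_inj coherent_family.induced_automorphism[OF coherent_family_branch]
  by (intro exI[of _ automorphism]) (auto simp: automorphism_def)

end

section \<open>Flexible spaces and cardinal arithmetic\<close>

context metrized_space
begin

text \<open>\<open>Y\<close> and the closure of its complement are closed, cover the space and meet
  in \<open>rel_bdry Y\<close>, where \<open>\<phi>\<close> is the identity.\<close>

lemma continuous_on_ext_id:
  assumes Y: "compact (Y :: 'x set)" and \<phi>: "continuous_on Y \<phi>" and bd: "\<And>y. y \<in> rel_bdry Y \<Longrightarrow> \<phi> y = y"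
  shows "continuous_on UNIV (ext_id Y \<phi>)"
proof -
  have "continuous_on Y (ext_id Y \<phi>)"
    using \<phi> by (rule continuous_on_eq) (simp add: ext_id_def)
  moreover have "continuous_on (closure (- Y)) (ext_id Y \<phi>)"
    using continuous_on_id by (rule continuous_on_eq) (simp add: ext_id_def rel_bdry_def bd)
  ultimately have "continuous_on (Y \<union> closure (- Y)) (ext_id Y \<phi>)"
    by (intro continuous_on_closed_Un compact_imp_closed[OF Y] closed_closure)
  moreover have "Y \<union> closure (- Y) = UNIV"
    using closure_subset[of "- Y"] by blast
  ultimately show ?thesis
    by simp
qed

lemma homeomorphism_ext_id:
  assumes Y: "compact (Y :: 'x set)" and \<phi>: "\<phi> \<in> Homeo_bd Y"
  shows "homeomorphism UNIV UNIV (ext_id Y \<phi>) (inv (ext_id Y \<phi>))"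
proof -
  obtain \<theta> where \<theta>: "homeomorphism Y Y \<phi> \<theta>" and bd: "\<And>y. y \<in> rel_bdry Y \<Longrightarrow> \<phi> y = y"
    using \<phi> by (auto simp: Homeo_bd_def)
  have \<theta>D: "\<And>y. y \<in> Y \<Longrightarrow> \<theta> (\<phi> y) = y" "\<And>y. y \<in> Y \<Longrightarrow> \<phi> (\<theta> y) = y"
    "\<And>y. y \<in> Y \<Longrightarrow> \<phi> y \<in> Y" "\<And>y. y \<in> Y \<Longrightarrow> \<theta> y \<in> Y"
    using \<theta> by (auto simp: homeomorphism_def)
  have bd': "\<theta> y = y" if "y \<in> rel_bdry Y" for y
    using bd[OF that] \<theta>D(1)[of y] that by (simp add: rel_bdry_def)
  have "homeomorphism UNIV UNIV (ext_id Y \<phi>) (ext_id Y \<theta>)"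
  proof (rule homeomorphismI)
    show "continuous_on UNIV (ext_id Y \<phi>)"
      using homeomorphism_cont1[OF \<theta>] bd by (rule continuous_on_ext_id[OF Y])
    show "continuous_on UNIV (ext_id Y \<theta>)"
      using homeomorphism_cont2[OF \<theta>] bd' by (rule continuous_on_ext_id[OF Y])
    show "ext_id Y \<theta> (ext_id Y \<phi> x) = x" "ext_id Y \<phi> (ext_id Y \<theta> x) = x" for x
      by (simp_all add: ext_id_def \<theta>D)
  qed simp_all
  then show ?thesis
    using homeomorphism_imp_inv by metis
qed

text \<open>Displacement vanishes off \<open>Y\<close> and is bounded on \<open>Y\<close> by
  compactness, so the supremum in \<open>radius\<close> is a genuine upper bound.\<close>

lemma displacement_le_radius:
  assumes Y: "compact (Y :: 'x set)" and \<phi>: "\<phi> \<in> Homeo_bd Y"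
  shows "d x (ext_id Y \<phi> x) \<le> radius d Y \<phi>"
  unfolding radius_def
proof (rule cSUP_upper)
  let ?u = "\<lambda>x. d x (ext_id Y \<phi> x)"
  have "continuous_on UNIV ?u"
    using homeomorphism_cont1[OF homeomorphism_ext_id[OF assms]] by (intro continuous_on_d continuous_on_id)
  then have "compact (?u ` Y)"
    by (intro compact_continuous_image[OF _ Y] continuous_on_subset[of UNIV ?u Y]) simp_all
  then have "bdd_above (insert 0 (?u ` Y))"
    by (simp add: bounded_imp_bdd_above compact_imp_bounded)
  moreover have "range ?u \<subseteq> insert 0 (?u ` Y)"
    by (auto simp: ext_id_def)
  ultimately show "bdd_above (range ?u)"
    by (rule bdd_above_mono)
qed simp

lemma radius_nonzero_imp: "radius d Y \<phi> \<noteq> 0 \<Longrightarrow> ext_id Y \<phi> \<noteq> id"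
  by (auto simp: radius_def)

end

text \<open>Radii tending to \<open>0\<close> supply some \<open>m\<close> with radius below any
  given \<open>e\<close>, and a nonzero radius keeps that extension from being the identity.\<close>

lemma flexible_imp_flexible_space:
  fixes d :: "'x::topological_space \<Rightarrow> 'x \<Rightarrow> real"
  assumes lc: "locally_compact_space (euclidean :: 'x topology)" and d: "compatible_metric d"
    and flexible: "flexible d"
  shows "\<exists>Y. flexible_space d Y"
proof -
  interpret metrized_space d
    by (rule metrized_space.intro[OF d])
  obtain Y :: "nat \<Rightarrow> 'x set" and \<phi> where *: "disjoint_family Y"
    "\<forall>n m. \<phi> n m \<in> Homeo_bd (Y n)" "\<forall>n. compact (Y n)"
    "\<forall>K. compact K \<longrightarrow> finite {n. Y n \<inter> K \<noteq> {}}"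
    "\<forall>n. decseq (\<lambda>m. radius d (Y n) (\<phi> n m)) \<and> (\<lambda>m. radius d (Y n) (\<phi> n m)) \<longlonglongrightarrow> 0 \<and>
      (\<forall>m. radius d (Y n) (\<phi> n m) \<noteq> 0)"
    using flexible unfolding flexible_def by (elim exE conjE) (rule that)
  have Y: "disjoint_family Y" "\<And>n. compact (Y n)"
    "\<And>K. compact K \<Longrightarrow> finite {n. Y n \<inter> K \<noteq> {}}"
    using * by simp_all
  have \<phi>: "\<And>n m. \<phi> n m \<in> Homeo_bd (Y n)"
    "\<And>n. (\<lambda>m. radius d (Y n) (\<phi> n m)) \<longlonglongrightarrow> 0" "\<And>n m. radius d (Y n) (\<phi> n m) \<noteq> 0"
    using * by simp_all
  have "flexible_space d Y"
  proof (intro flexible_space.intro flexible_space_axioms.intro)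
    show "metrized_space d"
      by (rule metrized_space.intro[OF d])
    show "finite {n. Y n \<inter> K \<noteq> {}}" if "compact K" for K
      using that by (rule Y(3))
    fix e :: real and n
    assume "e > 0"
    then have "\<forall>\<^sub>F m in sequentially. radius d (Y n) (\<phi> n m) < e"
      by (rule order_tendstoD(2)[OF \<phi>(2)])
    then obtain m where m: "radius d (Y n) (\<phi> n m) < e"
      by (auto simp: eventually_sequentially)
    show "\<exists>\<psi>. homeomorphism UNIV UNIV \<psi> (inv \<psi>) \<and> (\<forall>x. x \<notin> Y n \<longrightarrow> \<psi> x = x) \<and> \<psi> \<noteq> id \<and>
        (\<forall>x. d x (\<psi> x) \<le> e)"
    proof (intro exI[of _ "ext_id (Y n) (\<phi> n m)"] conjI allI impI)
      show "ext_id (Y n) (\<phi> n m) x = x" if "x \<notin> Y n" for x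
        using that by (simp add: ext_id_def)
      show "d x (ext_id (Y n) (\<phi> n m) x) \<le> e" for x
        using displacement_le_radius[OF Y(2) \<phi>(1), of x n m] m by linarith
    qed (rule homeomorphism_ext_id[OF Y(2) \<phi>(1)], rule radius_nonzero_imp[OF \<phi>(3)])
  qed (rule lc, rule Y(1), rule Y(2))
  then show ?thesis
    by blast
qed

section \<open>Cardinal estimates\<close>

lemma countable_underS_omega1:
  includes cardinal_syntax
  assumes "i \<in> omega1"
  shows "countable (underS (cardSuc natLeq) i)"
proof -
  have "|underS (cardSuc natLeq) i| <o cardSuc natLeq"
    by (rule card_of_underS[OF cardSuc_Card_order[OF natLeq_Card_order] assms])
  then have "|underS (cardSuc natLeq) i| \<le>o natLeq"
    by (simp add: cardSuc_ordLeq_ordLess[OF natLeq_Card_order card_of_Card_order])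
  then have "|underS (cardSuc natLeq) i| \<le>o |UNIV :: nat set|"
    by (rule ordLeq_ordIso_trans[OF _ ordIso_symmetric[OF card_of_nat]])
  then show ?thesis
    unfolding countable_def card_of_ordLeq[symmetric] by blast
qed

lemma Pow_lepoll_Pow: "A \<lesssim> B \<Longrightarrow> Pow A \<lesssim> Pow B"
  unfolding lepoll_def by (metis image_Pow_mono inj_on_image_Pow)

lemma nat_functions_lepoll_reals: "(UNIV :: (nat \<Rightarrow> nat) set) \<lesssim> (UNIV :: real set)"
proof -
  \<comment> \<open>A function is coded by the set of codes of the pairs in its graph.\<close>
  have "inj (\<lambda>f :: nat \<Rightarrow> nat. prod_encode ` {(n, f n) | n. True})"
  proof (rule injI)
    fix f g :: "nat \<Rightarrow> nat"
    assume "prod_encode ` {(n, f n) | n. True} = prod_encode ` {(n, g n) | n. True}"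
    then have "{(n, f n) | n. True} = {(n, g n) | n. True}"
      by (simp add: inj_image_eq_iff[OF inj_prod_encode])
    then show "f = g"
      by (fastforce simp: set_eq_iff)
  qed
  then have "(UNIV :: (nat \<Rightarrow> nat) set) \<lesssim> (UNIV :: nat set set)"
    unfolding lepoll_def by blast
  then show ?thesis
    using nat_sets_eqpoll_reals lepoll_trans eqpoll_imp_lepoll by blast
qed

lemma Pow_omega1_lepoll_automorphisms:
  fixes d :: "'x::topological_space \<Rightarrow> 'x \<Rightarrow> real" and a0 :: "'a::cstar_algebra"
  assumes "locally_compact_space (euclidean :: 'x topology)" "compatible_metric d" "flexible d" "a0 \<noteq> 0"
    and F: "dominating F" "F \<lesssim> omega1"
  shows "Pow omega1 \<lesssim> (Q_automorphisms :: (('x \<Rightarrow> 'a) set \<Rightarrow> ('x \<Rightarrow> 'a) set) set)"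
proof -
  obtain Y where "flexible_space d Y"
    using flexible_imp_flexible_space[OF assms(1-3)] by blast
  then interpret flexible_space d Y .
  obtain e where e: "inj_on e F" "e ` F \<subseteq> omega1"
    using F(2) by (auto simp: lepoll_def)
  \<comment> \<open>\<open>inv_into F e\<close> reindexes \<open>F\<close> by \<open>omega1\<close>;
    outside the image of \<open>e\<close> its values are arbitrary, which is harmless since
    domination asks for just one suitable index.\<close>
  interpret branching d Y "cardSuc natLeq" "inv_into F e" a0
  proof unfold_locales
    show "Well_order (cardSuc natLeq)"
      using cardSuc_Card_order[OF natLeq_Card_order] by (rule card_order_on_well_order_on)
    show "\<exists>i\<in>omega1. \<forall>\<^sub>F n in sequentially. g n \<le> inv_into F e i n" for g
    proof -
      obtain h where h: "h \<in> F" "\<forall>\<^sub>F n in sequentially. g n \<le> h n"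
        using F(1) unfolding dominating_def by blast
      then show ?thesis
        using e by (intro bexI[of _ "e h"]) auto
    qed
  qed (use assms(4) countable_underS_omega1 in auto)
  show ?thesis
    by (rule Pow_lepoll_automorphisms)
qed

theorem theorem3p1:
  fixes d :: "'x::topological_space \<Rightarrow> 'x \<Rightarrow> real"
  assumes "locally_compact_space (euclidean :: 'x topology)"
    and "\<not> compact (UNIV :: 'x set)"
    and "Polish_top (euclidean :: 'x topology)"
    and "compatible_metric d"
    and "flexible d"
    and "\<exists>a::'a::cstar_algebra. a \<noteq> 0"
  shows "(dominating_number_is_omega1 \<and> Pow (UNIV :: nat set) \<prec> Pow omega1
            \<longrightarrow> Pow omega1 \<lesssim> (Q_automorphisms :: (('x \<Rightarrow> 'a) set \<Rightarrow> ('x \<Rightarrow> 'a) set) set))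
       \<and> ((UNIV :: real set) \<approx> omega1
            \<longrightarrow> Pow (UNIV :: real set) \<lesssim> (Q_automorphisms :: (('x \<Rightarrow> 'a) set \<Rightarrow> ('x \<Rightarrow> 'a) set) set))"
proof -
  obtain a0 :: 'a where "a0 \<noteq> 0"
    using assms(6) by blast
  note main = Pow_omega1_lepoll_automorphisms[OF assms(1,4,5) this]
  show ?thesis
  proof (intro conjI impI)
    assume "dominating_number_is_omega1 \<and> Pow (UNIV :: nat set) \<prec> Pow omega1"
    then obtain F where "dominating F" "F \<approx> omega1"
      by (auto simp: dominating_number_is_omega1_def)
    then show "Pow omega1 \<lesssim> (Q_automorphisms :: (('x \<Rightarrow> 'a) set \<Rightarrow> ('x \<Rightarrow> 'a) set) set)"
      by (intro main eqpoll_imp_lepoll)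
  next
    assume "(UNIV :: real set) \<approx> omega1"
    then have reals: "(UNIV :: real set) \<lesssim> omega1"
      by (rule eqpoll_imp_lepoll)
    \<comment> \<open>Under CH the family of all functions serves: it is trivially dominating, and
      its cardinality is at most that of the reals.\<close>
    have "\<exists>f\<in>UNIV. \<forall>\<^sub>F n in sequentially. g n \<le> f n" for g :: "nat \<Rightarrow> nat"
      by (rule bexI[of _ g]) simp_all
    then have "dominating UNIV"
      unfolding dominating_def by (intro allI)
    then have "Pow omega1 \<lesssim> (Q_automorphisms :: (('x \<Rightarrow> 'a) set \<Rightarrow> ('x \<Rightarrow> 'a) set) set)"
      by (rule main[OF _ lepoll_trans[OF nat_functions_lepoll_reals reals]])
    then show "Pow (UNIV :: real set) \<lesssim> (Q_automorphisms :: (('x \<Rightarrow> 'a) set \<Rightarrow> ('x \<Rightarrow> 'a) set) set)"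
      by (rule lepoll_trans[OF Pow_lepoll_Pow[OF reals]])
  qed
qed

end
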